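(* For any real $k > 0$, Ramanujan's $\psi$-function satisfies $$\psi\left(e^{-k\pi}\right) = \int_0^{\infty} \frac{e^{-t^2/2}}{\sqrt{2\pi}} \left[ \frac{\cos\left(\sqrt{k \pi}\, t\right) - e^{k\pi / 2}}{\cos\left(\sqrt{k \pi}\, t\right) - \cosh\left(\frac{k\pi}{2}\right)} \right] dt.$$ The explicit values of this function at $k \in \{1, 2, 1/2\}$ have the following respective integral representations: $$\frac{\pi^{1/4}}{\Gamma\left(\frac{3}{4}\right)} \cdot \frac{e^{\pi / 8}}{2^{5/8}} = \int_0^{\infty} \frac{e^{-t^2/2}}{\sqrt{2\pi}} \left[ \frac{\cos\left(\sqrt{\pi}\, t\right) - e^{\pi / 2}}{\cos\left(\sqrt{\pi}\, t\right) - \cosh\left(\frac{\pi}{2}\right)} \right] dt,$$ $$\frac{\pi^{1/4}}{\Gamma\left(\frac{3}{4}\right)} \cdot \frac{e^{\pi / 4}}{2^{5/4}} = \int_0^{\infty} \frac{e^{-t^2/2}}{\sqrt{2\pi}} \left[ \frac{\cos\left(\sqrt{2 \pi}\, t\right) - e^{\pi}}{\cos\left(\sqrt{2 \pi}\, t\right) - \cosh\left(\pi\right)} \right] dt,$$ $$\frac{\pi^{1/4}}{\Gamma\left(\frac{3}{4}\right)} \cdot \frac{\left(\sqrt{2} + 1\right)^{1/4} e^{\pi / 16}}{2^{7/16}} = \int_0^{\infty} \frac{e^{-t^2/2}}{\sqrt{2\pi}} \left[ \frac{\cos\left(\sqrt{\frac{\pi}{2}}\, t\right) - e^{\pi / 4}}{\cos\left(\sqrt{\frac{\pi}{2}}\,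 t\right) - \cosh\left(\frac{\pi}{4}\right)} \right] dt.$$
   Context: Ramanujan's $\psi$-function is $\psi(q) := \sum_{n=0}^{\infty} q^{n(n+1)/2}$ for $|q| < 1$; in terms of the Jacobi theta function $\vartheta_2(q) = 2 q^{1/4}\sum_{n=0}^{\infty} q^{n(n+1)}$ one has $\psi(e^{-k\pi}) = \frac{1}{2} e^{k\pi/8} \vartheta_2(e^{-k\pi/2})$. $\Gamma$ is the gamma function. *)

theory Defs
  imports "HOL-Analysis.Analysis"
begin

text \<open>
  Ramanujan's psi function. It is meaningful only for \<open>norm q < 1\<close>, where the series converges.
  The exponent is a triangular number, so the natural-number division by 2 is exact.
\<close>
definition ramanujan_psi :: "'a::{real_normed_field, banach} \<Rightarrow> 'a" where
  "ramanujan_psi q = (\<Sum>n. q ^ (n * (n + 1) div 2))"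

lemma summable_ramanujan_psi:
  fixes q :: "'a::{real_normed_field, banach}"
  assumes "norm q < 1"
  shows "summable (\<lambda>n. q ^ (n * (n + 1) div 2))"
proof (rule summable_comparison_test')
  show "summable (\<lambda>n. norm q ^ n)"
    using assms by (simp add: summable_geometric)
next
  fix n :: nat assume "0 \<le> n"
  have "n \<le> n * (n + 1) div 2"
    by (cases n) auto
  then show "norm (q ^ (n * (n + 1) div 2)) \<le> norm q ^ n"
    using assms by (simp add: norm_power power_decreasing)
qed

end

theory Submission
  imports Defs "HOL-Probability.Probability"
begin

text \<open>
  The integral representation comes from the Poisson kernel: the bracketed quotient is
  \<open>2 \<Sum>\<^sub>n r\<^sup>n cos (n \<theta>)\<close> with \<open>r = e\<^sup>-\<^sup>k\<^sup>\<pi>\<^sup>/\<^sup>2\<close> and \<open>\<theta> = \<surd>(k\<pi>) t\<close>, and the Gaussian integral of \<open>cos (n \<theta>)\<close> over the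
  half-line is \<open>exp (- n\<^sup>2 k \<pi> / 2) / 2\<close>. Termwise integration
  (\<open>ramanujan_psi_integral_representation\<close>) gives the series of \<open>\<psi>(e\<^sup>-\<^sup>k\<^sup>\<pi>)\<close>.

  The special values rest on \<open>\<vartheta>\<^sub>3(e\<^sup>-\<^sup>\<pi>) = \<pi>\<^sup>1\<^sup>/\<^sup>4 / \<Gamma>(3/4)\<close> (\<open>theta3_at_1\<close>), obtained from the
  arithmetic-geometric mean. Let \<open>J(a, b)\<close> be the integral of
  \<open>1 / sqrt ((t\<^sup>2 + a\<^sup>2) (t\<^sup>2 + b\<^sup>2))\<close> over the positive half-line. By Landen's transformation
  (\<open>agm_int_landen\<close>), \<open>J\<close> does not change when \<open>(a, b)\<close> is replaced by its arithmetic and geometric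
  means. A single product formula for theta series (\<open>shifted_theta_mult\<close>) shows that squaring \<open>q\<close>
  performs this replacement on \<open>(\<vartheta>\<^sub>3\<^sup>2, \<vartheta>\<^sub>4\<^sup>2)\<close>, and that it undoes it, up to a factor two, on \<open>(\<vartheta>\<^sub>3\<^sup>2, \<vartheta>\<^sub>2\<^sup>2)\<close>.
  Iterating from \<open>q = e\<^sup>-\<^sup>\<pi>\<close>, the first pair tends to \<open>(1, 1)\<close>, hence \<open>J(\<vartheta>\<^sub>3\<^sup>2, \<vartheta>\<^sub>4\<^sup>2) = \<pi> / 2\<close>; for the second
  pair the integral doubles in each step while it grows like the logarithm of \<open>1 / \<vartheta>\<^sub>2\<^sup>2\<close>, hence
  \<open>J(\<vartheta>\<^sub>3\<^sup>2, \<vartheta>\<^sub>2\<^sup>2) = \<pi> / 2\<close> as well. As \<open>J\<close> is strictly monotonic, \<open>\<vartheta>\<^sub>2 = \<vartheta>\<^sub>4\<close> at \<open>q = e\<^sup>-\<^sup>\<pi>\<close>, a fact usually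
  read off from the modular transformation of theta functions, which is thereby avoided. Jacobi's
  quartic identity now gives \<open>\<vartheta>\<^sub>3\<^sup>2 = \<surd>2 \<vartheta>\<^sub>2\<^sup>2\<close>, so that \<open>J\<close> becomes the lemniscatic integral
  \<open>J(\<surd>2, 1)\<close>, a Beta value.

  Finally \<open>\<psi>(e\<^sup>-\<^sup>2\<^sup>\<pi>\<^sup>s)\<close> is \<open>\<vartheta>\<^sub>2(e\<^sup>-\<^sup>\<pi>\<^sup>s)\<close> up to an elementary factor, and the duplication formulas
  carry the value of \<open>\<vartheta>\<^sub>2\<close> at \<open>s = 1\<close> to \<open>s = 1/2\<close> and \<open>s = 1/4\<close>.
\<close>

section \<open>The Gaussian integral representation\<close>

lemma std_normal_cos_integrable: "integrable lborel (\<lambda>t. std_normal_density t * cos (x * t))"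
proof (rule Bochner_Integration.integrable_bound)
  show "integrable lborel std_normal_density" by (rule integrable_normal_density) simp
  show "AE t in lborel. norm (std_normal_density t * cos (x * t)) \<le> norm (std_normal_density t)"
    by (auto simp: abs_mult mult_left_le)
qed measurable

text \<open>
  This is the real part of the characteristic function of the standard normal distribution.
\<close>
lemma std_normal_cos_integral:
  "(LINT t|lborel. std_normal_density t * cos (x * t)) = exp (- (x\<^sup>2) / 2)"
proof -
  have "integrable lborel (\<lambda>t. std_normal_density t *\<^sub>R iexp (x * t))"
  proof (rule Bochner_Integration.integrable_bound)
    show "integrable lborel std_normal_density" by (rule integrable_normal_density) simp
  qed auto
  from integral_Re[OF this]
  have "(LINT t|lborel. std_normal_density t * cos (x * t)) =
      Re (CLINT t|lborel. std_normal_density t *\<^sub>R iexp (x * t))"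
    by (simp add: Re_exp)
  also have "(CLINT t|lborel. std_normal_density t *\<^sub>R iexp (x * t)) = char std_normal_distribution x"
    unfolding char_def by (subst integral_density) auto
  also have "Re \<dots> = exp (- (x\<^sup>2) / 2)"
    unfolding char_std_normal_distribution by simp
  finally show ?thesis .
qed

lemma std_normal_cos_half_integral:
  "has_bochner_integral lborel (\<lambda>t. indicator {0..} t *\<^sub>R (std_normal_density t * cos (x * t)))
     (exp (- (x\<^sup>2) / 2) / 2)"
proof -
  let ?f = "\<lambda>t. std_normal_density t * cos (x * t)"
  define v where "v = (LINT t|lborel. indicator {0..} t *\<^sub>R ?f t)"
  have int: "integrable lborel (\<lambda>t. indicator {0..} t *\<^sub>R ?f t)"
    using std_normal_cos_integrable by (rule integrable_mult_indicator[rotated]) simp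
  then have v: "has_bochner_integral lborel (\<lambda>t. indicator {0..} t *\<^sub>R ?f t) v"
    unfolding v_def by (rule has_bochner_integral_integrable)
  then have "has_bochner_integral lborel ?f (2 *\<^sub>R v)"
    by (rule has_bochner_integral_even_function) (simp add: std_normal_density_def)
  then have "2 * v = exp (- (x\<^sup>2) / 2)"
    using std_normal_cos_integral[of x] by (simp add: has_bochner_integral_iff)
  then have "v = exp (- (x\<^sup>2) / 2) / 2" by simp
  with v show ?thesis by simp
qed

text \<open>
  The left-hand side is the real part of the geometric series in \<open>r e\<^sup>i\<^sup>\<theta>\<close> with \<open>r = e\<^sup>-\<^sup>a\<close>; clearing
  denominators turns the real part of \<open>1 / (1 - r e\<^sup>i\<^sup>\<theta>)\<close> into a quotient free of \<open>r\<close>.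
\<close>
lemma poisson_cosine_series:
  assumes a: "a > 0"
  shows "(\<lambda>n. exp (- a) ^ n * cos (real n * \<theta>)) sums
    ((cos \<theta> - exp a) / (cos \<theta> - cosh a) / 2)"
proof -
  define r where "r = exp (- a)"
  have r: "0 < r" "r < 1" using a by (auto simp: r_def)
  define z where "z = rcis r \<theta>"
  have "norm z < 1" using r by (simp add: z_def)
  from sums_Re[OF geometric_sums[OF this]]
  have "(\<lambda>n. r ^ n * cos (real n * \<theta>)) sums Re (1 / (1 - z))"
    by (simp add: z_def DeMoivre2)
  also have "Re (1 / (1 - z)) = (1 - r * cos \<theta>) / ((1 - r * cos \<theta>)\<^sup>2 + (r * sin \<theta>)\<^sup>2)"
    by (simp add: z_def Re_divide power2_eq_square)
  also have "(1 - r * cos \<theta>)\<^sup>2 + (r * sin \<theta>)\<^sup>2 = 2 * r * (cosh a - cos \<theta>)"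
  proof -
    have "exp a = 1 / r" by (simp add: r_def exp_minus field_simps)
    then have "2 * r * cosh a = 1 + r\<^sup>2"
      using r by (simp add: cosh_def r_def[symmetric] field_simps power2_eq_square)
    moreover have "(1 - r * cos \<theta>)\<^sup>2 + (r * sin \<theta>)\<^sup>2 = 1 - 2 * r * cos \<theta> + r\<^sup>2 * ((sin \<theta>)\<^sup>2 + (cos \<theta>)\<^sup>2)"
      by algebra
    ultimately show ?thesis by (simp add: algebra_simps)
  qed
  also have "(1 - r * cos \<theta>) / (2 * r * (cosh a - cos \<theta>)) = (cos \<theta> - exp a) / (cos \<theta> - cosh a) / 2"
  proof -
    have e: "1 - r * cos \<theta> = r * (exp a - cos \<theta>)"
      by (simp add: r_def exp_minus field_simps)
    have "r * (exp a - cos \<theta>) / (2 * r * (cosh a - cos \<theta>)) =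
        (exp a - cos \<theta>) / (cosh a - cos \<theta>) / 2"
      using r by simp
    also have "(exp a - cos \<theta>) / (cosh a - cos \<theta>) = (cos \<theta> - exp a) / (cos \<theta> - cosh a)"
      by (metis minus_diff_eq minus_divide_divide)
    finally show ?thesis unfolding e .
  qed
  finally show ?thesis unfolding r_def .
qed

text \<open>
  The bracketed quotient is \<open>2 \<Sum>\<^sub>n r\<^sup>n cos (n \<theta>)\<close> with \<open>r = e\<^sup>-\<^sup>k\<^sup>\<pi>\<^sup>/\<^sup>2\<close> and \<open>\<theta> = \<surd>(k\<pi>) t\<close>. Integrating termwise
  against the Gaussian multiplies \<open>r\<^sup>n\<close> by \<open>exp (- n\<^sup>2 k \<pi> / 2)\<close>, and the two exponents add up to
  \<open>- k \<pi>\<close> times the triangular number \<open>n (n + 1) / 2\<close>. The interchange is dominated by \<open>2 r\<^sup>n\<close>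
  times the normal density.
\<close>
lemma ramanujan_psi_integral_representation:
  fixes k :: real
  assumes k: "k > 0"
  defines "f \<equiv> \<lambda>t::real. exp (- (t\<^sup>2) / 2) / sqrt (2 * pi) *
     ((cos (sqrt (k * pi) * t) - exp (k * pi / 2)) / (cos (sqrt (k * pi) * t) - cosh (k * pi / 2)))"
  shows "set_integrable lborel {0..} f" "ramanujan_psi (exp (- k * pi)) = (LBINT t:{0..}. f t)"
proof -
  define r where "r = exp (- (k * pi / 2))"
  define c where "c = sqrt (k * pi)"
  have r: "0 < r" "r < 1" using k by (auto simp: r_def)
  define h where "h = (\<lambda>n t. 2 * r ^ n * (indicator {0..} t *\<^sub>R (std_normal_density t * cos (real n * c * t))))"
  have h_sums: "(\<lambda>n. h n t) sums (indicator {0..} t *\<^sub>R f t)" for t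
  proof -
    define w where "w = (cos (c * t) - exp (k * pi / 2)) / (cos (c * t) - cosh (k * pi / 2))"
    have "(\<lambda>n. 2 * (indicator {0..} t * std_normal_density t) * (r ^ n * cos (real n * (c * t)))) sums
        (2 * (indicator {0..} t * std_normal_density t) * (w / 2))"
      unfolding r_def w_def using k by (intro sums_mult poisson_cosine_series) simp
    moreover have "2 * (indicator {0..} t * std_normal_density t) * (r ^ n * cos (real n * (c * t))) = h n t" for n
      by (simp add: h_def mult_ac)
    moreover have "f t = std_normal_density t * w"
      unfolding f_def c_def[symmetric] w_def[symmetric] std_normal_density_def by simp
    ultimately show ?thesis by simp
  qed
  have h_int: "has_bochner_integral lborel (h n) (exp (- k * pi) ^ (n * (n + 1) div 2))" for n
  proof -
    have "has_bochner_integral lborel (h n) (2 * r ^ n * (exp (- ((real n * c)\<^sup>2) / 2) / 2))"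
      unfolding h_def by (intro has_bochner_integral_mult_right std_normal_cos_half_integral)
    also have "2 * r ^ n * (exp (- ((real n * c)\<^sup>2) / 2) / 2) = exp (- k * pi) ^ (n * (n + 1) div 2)"
    proof -
      have "c\<^sup>2 = k * pi" using k by (simp add: c_def)
      moreover have "real (n * (n + 1) div 2) = real n * (real n + 1) / 2"
        by (subst real_of_nat_div) (auto simp: algebra_simps)
      ultimately show ?thesis
        unfolding r_def exp_of_nat_mult[symmetric]
        by (simp add: power_mult_distrib mult_exp_exp) (simp add: field_simps power2_eq_square)
    qed
    finally show ?thesis .
  qed
  have integrable: "integrable lborel (h n)" for n using h_int by (simp add: has_bochner_integral_iff)
  have bound: "norm (h n t) \<le> 2 * r ^ n * std_normal_density t" for n t
    unfolding h_def using r by (auto simp: abs_mult mult_left_le indicator_def)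
  have summable: "AE t in lborel. summable (\<lambda>n. norm (h n t))"
  proof (rule AE_I2)
    fix t :: real
    have "summable (\<lambda>n. 2 * r ^ n * std_normal_density t)"
      using r by (intro summable_mult summable_mult2 summable_geometric) auto
    then show "summable (\<lambda>n. norm (h n t))"
      by (rule summable_comparison_test'[where N = 0]) (use bound in auto)
  qed
  have summable_norm: "summable (\<lambda>n. LINT t|lborel. norm (h n t))"
  proof (rule summable_comparison_test'[where N = 0])
    show "summable (\<lambda>n. 2 * r ^ n)" using r by (intro summable_mult summable_geometric) auto
    fix n
    have "(LINT t|lborel. norm (h n t)) \<le> (LINT t|lborel. 2 * r ^ n * std_normal_density t)"
      by (intro integral_mono integrable_norm integrable bound integrable_mult_right integrable_normal_density) simp
    also have "\<dots> = 2 * r ^ n" by simp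
    finally show "norm (LINT t|lborel. norm (h n t)) \<le> 2 * r ^ n" by simp
  qed
  have suminf: "(\<Sum>n. h n t) = indicator {0..} t *\<^sub>R f t" for t
    using h_sums by (simp add: sums_iff)
  show "set_integrable lborel {0..} f"
    using integrable_suminf[OF integrable summable summable_norm]
    unfolding set_integrable_def suminf .
  show "ramanujan_psi (exp (- k * pi)) = (LBINT t:{0..}. f t)"
    using integral_suminf[OF integrable summable summable_norm] h_int
    unfolding set_lebesgue_integral_def ramanujan_psi_def suminf by (simp add: has_bochner_integral_iff)
qed

section \<open>Theta series and their product formula\<close>

text \<open>
  With \<open>q = e\<^sup>-\<^sup>\<pi>\<^sup>s\<close> this is the sum of the powers of \<open>q\<close> with exponents \<open>(n + x)\<^sup>2\<close>, \<open>n\<close> an integer. The shift \<open>x = 0\<close>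
  gives Jacobi's \<open>\<vartheta>\<^sub>3\<close> and \<open>x = 1/2\<close> gives \<open>\<vartheta>\<^sub>2\<close>, so one product formula covers both. Squaring \<open>q\<close>
  doubles \<open>s\<close>.
\<close>
definition shifted_theta :: "real \<Rightarrow> real \<Rightarrow> real" where
  "shifted_theta x s = (\<Sum>\<^sub>\<infinity>n::int. exp (- pi * s * (of_int n + x)\<^sup>2))"

lemma UNIV_int_split: "(UNIV :: int set) = range int \<union> range (\<lambda>n. - int n - 1)"
proof -
  have "k \<in> range int \<union> range (\<lambda>n. - int n - 1)" for k :: int
  proof (cases "k \<ge> 0")
    case True
    then have "k = int (nat k)" by simp
    then show ?thesis by blast
  next
    case False
    then have "k = - int (nat (- k - 1)) - 1" by simp
    then show ?thesis by blast
  qed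
  then show ?thesis by blast
qed

lemma inj_neg_int: "inj (\<lambda>n. - int n - 1)"
  by (auto intro: injI)

lemma summable_on_intI:
  fixes f :: "int \<Rightarrow> real"
  assumes "summable (\<lambda>n. f (int n))" "summable (\<lambda>n. f (- int n - 1))" "\<And>k. f k \<ge> 0"
  shows "f summable_on UNIV"
proof -
  have "f summable_on range int"
    using assms summable_nonneg_imp_summable_on[of "\<lambda>n. f (int n)"]
    by (subst summable_on_reindex) (auto simp: o_def)
  moreover have "f summable_on range (\<lambda>n. - int n - 1)"
    using assms summable_nonneg_imp_summable_on[of "\<lambda>n. f (- int n - 1)"]
    by (subst summable_on_reindex[OF inj_neg_int]) (auto simp: o_def)
  moreover have "range int \<inter> range (\<lambda>n. - int n - 1) = {}" by auto
  ultimately show ?thesis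
    unfolding UNIV_int_split by (intro summable_on_Un_disjoint)
qed

text \<open>
  The elementary bound \<open>v - 1 \<le> v\<^sup>2\<close> reduces the Gaussian terms to a geometric series.
\<close>
lemma summable_gauss_nat:
  assumes "s > 0" shows "summable (\<lambda>n. exp (- pi * s * (real n + x)\<^sup>2))"
proof (rule summable_comparison_test')
  define r where "r = exp (- pi * s)"
  have "r < 1" "r > 0" using assms by (auto simp: r_def)
  show "summable (\<lambda>n. exp (pi * s * (\<bar>x\<bar> + 1)) * r ^ n)"
    using \<open>r < 1\<close> \<open>r > 0\<close> by (intro summable_mult summable_geometric) auto
  fix n :: nat
  have "v - 1 \<le> v\<^sup>2" for v :: real
    using zero_le_power2[of "v - 1/2"] by (simp add: power2_eq_square algebra_simps)
  moreover have "real n - (\<bar>x\<bar> + 1) \<le> (real n + x) - 1"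
    using abs_ge_minus_self[of x] by linarith
  ultimately have "real n - (\<bar>x\<bar> + 1) \<le> (real n + x)\<^sup>2"
    using order_trans by blast
  then have "pi * s * (real n - (\<bar>x\<bar> + 1)) \<le> pi * s * (real n + x)\<^sup>2"
    using assms by (intro mult_left_mono) auto
  then have "- pi * s * (real n + x)\<^sup>2 \<le> pi * s * (\<bar>x\<bar> + 1) + real n * (- pi * s)"
    by (simp add: algebra_simps)
  then show "norm (exp (- pi * s * (real n + x)\<^sup>2)) \<le> exp (pi * s * (\<bar>x\<bar> + 1)) * r ^ n"
    unfolding r_def exp_of_nat_mult[symmetric] exp_add[symmetric] by simp
qed

lemma summable_shifted_theta:
  assumes "s > 0"
  shows "(\<lambda>n::int. exp (- pi * s * (of_int n + x)\<^sup>2)) summable_on UNIV"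
proof (rule summable_on_intI)
  show "summable (\<lambda>n. exp (- pi * s * (of_int (int n) + x)\<^sup>2))"
    using summable_gauss_nat[OF assms, of x] by simp
  have "(real_of_int (- int n - 1) + x)\<^sup>2 = (real n + (1 - x))\<^sup>2" for n
    by (simp add: power2_eq_square algebra_simps)
  then show "summable (\<lambda>n. exp (- pi * s * (of_int (- int n - 1) + x)\<^sup>2))"
    using summable_gauss_nat[OF assms, of "1 - x"] by simp
qed simp

lemma shifted_theta_has_sum:
  assumes "s > 0"
  shows "((\<lambda>n::int. exp (- pi * s * (of_int n + x)\<^sup>2)) has_sum shifted_theta x s) UNIV"
  using summable_shifted_theta[OF assms] unfolding shifted_theta_def by simp

lemma shifted_theta_plus_one: "shifted_theta (x + 1) s = shifted_theta x s"
proof -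
  have "bij (\<lambda>n::int. n + 1)"
    by (rule bij_betw_byWitness[where f' = "\<lambda>n. n - 1"]) auto
  from infsum_reindex_bij_betw[OF this, of "\<lambda>n. exp (- pi * s * (of_int n + x)\<^sup>2)"]
  show ?thesis by (simp add: shifted_theta_def add_ac)
qed

lemma shifted_theta_prod_has_sum:
  assumes "s > 0"
  shows "((\<lambda>(m::int, n::int). exp (- pi * s * (of_int m + x)\<^sup>2) * exp (- pi * s * (of_int n + y)\<^sup>2))
      has_sum (shifted_theta x s * shifted_theta y s)) UNIV"
proof -
  let ?f = "\<lambda>x n::int. exp (- pi * s * (of_int n + x)\<^sup>2)"
  have inner: "((\<lambda>n. ?f x m * ?f y n) has_sum (?f x m * shifted_theta y s)) UNIV" for m
    by (intro has_sum_cmult_right shifted_theta_has_sum assms)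
  have outer: "((\<lambda>m. ?f x m * shifted_theta y s) has_sum (shifted_theta x s * shifted_theta y s)) UNIV"
    by (intro has_sum_cmult_left shifted_theta_has_sum assms)
  have "(\<lambda>(m, n). ?f x m * ?f y n) summable_on (UNIV \<times> UNIV)"
    using inner outer by (intro summable_on_SigmaI[where g="\<lambda>m. ?f x m * shifted_theta y s"])
      (auto simp: has_sum_imp_summable)
  from has_sum_SigmaI[OF _ outer this] inner
  show ?thesis by (simp only: UNIV_Times_UNIV case_prod_conv)
qed

text \<open>
  The double series runs over the lattice of pairs \<open>(m, n)\<close>. Rotating the lattice by 45 degrees, that is,
  passing to half the sum and half the difference of \<open>m + x\<close> and \<open>n + y\<close>, doubles the quadratic form.
  The pairs with \<open>m + n\<close> even form one sublattice product and those with \<open>m + n\<close> odd another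
  one, shifted by \<open>1/2\<close> in both coordinates; these are the two summands.
\<close>
lemma shifted_theta_mult:
  assumes s: "s > 0"
  shows "shifted_theta x s * shifted_theta y s =
    shifted_theta ((x + y) / 2) (2 * s) * shifted_theta ((x - y) / 2) (2 * s) +
    shifted_theta ((x + y + 1) / 2) (2 * s) * shifted_theta ((x - y + 1) / 2) (2 * s)"
proof -
  define F where "F = (\<lambda>(m::int, n::int).
    exp (- pi * s * (of_int m + x)\<^sup>2) * exp (- pi * s * (of_int n + y)\<^sup>2))"
  define G where "G = (\<lambda>u v (a::int, b::int).
    exp (- pi * (2 * s) * (of_int a + u)\<^sup>2) * exp (- pi * (2 * s) * (of_int b + v)\<^sup>2))"
  define e where "e = (\<lambda>(a::int, b::int). (a + b, a - b))"
  define d where "d = (\<lambda>(a::int, b::int). (a + b + 1, a - b))"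
  have inj: "inj e" "inj d" by (auto simp: e_def d_def inj_on_def)
  \<comment> \<open>parallelogram identity: \<open>p\<^sup>2 + q\<^sup>2 = 2 ((p + q) / 2)\<^sup>2 + 2 ((p - q) / 2)\<^sup>2\<close>\<close>
  have exp_eq: "exp (- pi * s * p\<^sup>2) * exp (- pi * s * q\<^sup>2) =
      exp (- pi * (2 * s) * ((p + q) / 2)\<^sup>2) * exp (- pi * (2 * s) * ((p - q) / 2)\<^sup>2)" for p q
    unfolding exp_add[symmetric] by (simp add: power2_eq_square field_simps)
  have Fe: "F \<circ> e = G ((x + y) / 2) ((x - y) / 2)"
    unfolding F_def e_def G_def o_def case_prod_unfold exp_eq
    by (simp add: add_divide_distrib diff_divide_distrib algebra_simps)
  have Fd: "F \<circ> d = G ((x + y + 1) / 2) ((x - y + 1) / 2)"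
    unfolding F_def d_def G_def o_def case_prod_unfold exp_eq
    by (simp add: add_divide_distrib diff_divide_distrib algebra_simps)
  have G: "(G u v has_sum (shifted_theta u (2 * s) * shifted_theta v (2 * s))) UNIV" for u v
    unfolding G_def by (rule shifted_theta_prod_has_sum) (use s in simp)
  have "(F has_sum (shifted_theta ((x + y) / 2) (2 * s) * shifted_theta ((x - y) / 2) (2 * s))) (range e)"
    using G by (subst has_sum_reindex[OF inj(1)]) (simp add: Fe)
  moreover have "(F has_sum (shifted_theta ((x + y + 1) / 2) (2 * s) * shifted_theta ((x - y + 1) / 2) (2 * s))) (range d)"
    using G by (subst has_sum_reindex[OF inj(2)]) (simp add: Fd)
  moreover have "range e \<inter> range d = {}"
  proof -
    have "even (fst p + snd p)" if "p \<in> range e" for p using that by (auto simp: e_def)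
    moreover have "odd (fst p + snd p)" if "p \<in> range d" for p using that by (auto simp: d_def)
    ultimately show ?thesis by blast
  qed
  moreover have "range e \<union> range d = UNIV"
  proof -
    have "(m, n) \<in> range e \<union> range d" for m n :: int
    proof (cases "even (m + n)")
      case True
      then obtain k where "m + n = 2 * k" by (elim evenE)
      then have "(m, n) = e (k, m - k)" by (simp add: e_def)
      then show ?thesis by blast
    next
      case False
      then obtain k where "m + n = 2 * k + 1" by (elim oddE)
      then have "(m, n) = d (k, m - 1 - k)" by (simp add: d_def)
      then show ?thesis by blast
    qed
    then show ?thesis by auto
  qed
  ultimately have "(F has_sum (shifted_theta ((x + y) / 2) (2 * s) * shifted_theta ((x - y) / 2) (2 * s) +
    shifted_theta ((x + y + 1) / 2) (2 * s) * shifted_theta ((x - y + 1) / 2) (2 * s))) UNIV"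
    by (metis (no_types) has_sum_Un_disjoint)
  moreover have "(F has_sum (shifted_theta x s * shifted_theta y s)) UNIV"
    unfolding F_def by (rule shifted_theta_prod_has_sum[OF s])
  ultimately show ?thesis by (metis (no_types) has_sum_unique)
qed

abbreviation "theta3 \<equiv> shifted_theta 0"
abbreviation "theta2 \<equiv> shifted_theta (1/2)"

lemma theta3_squared_double: "s > 0 \<Longrightarrow> (theta3 s)\<^sup>2 = (theta3 (2 * s))\<^sup>2 + (theta2 (2 * s))\<^sup>2"
  using shifted_theta_mult[of s 0 0] by (simp add: power2_eq_square)

lemma theta2_squared_double: "s > 0 \<Longrightarrow> (theta2 s)\<^sup>2 = 2 * theta2 (2 * s) * theta3 (2 * s)"
  using shifted_theta_mult[of s "1/2" "1/2"] shifted_theta_plus_one[of 0 "2 * s"]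
  by (simp add: power2_eq_square)

text \<open>
  The reflection \<open>n \<mapsto> - n - 1\<close> fixes \<open>(n + 1/2)\<^sup>2 = n (n + 1) + 1/4\<close>, so the two half-lines contribute equally.
\<close>
lemma theta2_eq_ramanujan_psi:
  assumes s: "s > 0"
  shows "theta2 s = 2 * exp (- pi * s / 4) * ramanujan_psi (exp (- 2 * pi * s))"
proof -
  let ?f = "\<lambda>k::int. exp (- pi * s * (of_int k + 1/2)\<^sup>2)"
  let ?g = "\<lambda>n. exp (- pi * s / 4) * exp (- 2 * pi * s) ^ (n * (n + 1) div 2)"
  have tri: "real (n * (n + 1) div 2) = real n * (real n + 1) / 2" for n
    by (subst real_of_nat_div) (auto simp: algebra_simps)
  have f1: "?f (int n) = ?g n" for n
    unfolding exp_of_nat_mult[symmetric] exp_add[symmetric] tri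
    by (simp add: power2_eq_square field_simps)
  have f2: "?f (- int n - 1) = ?g n" for n
    unfolding exp_of_nat_mult[symmetric] exp_add[symmetric] tri
    by (simp add: power2_eq_square field_simps)
  have "summable (\<lambda>n. exp (- 2 * pi * s) ^ (n * (n + 1) div 2))"
    using s by (intro summable_ramanujan_psi) auto
  then have "?g sums (exp (- pi * s / 4) * ramanujan_psi (exp (- 2 * pi * s)))"
    unfolding ramanujan_psi_def by (intro sums_mult summable_sums)
  then have g: "(?g has_sum (exp (- pi * s / 4) * ramanujan_psi (exp (- 2 * pi * s)))) UNIV"
    by (rule sums_nonneg_imp_has_sum) simp
  have "(?f has_sum (exp (- pi * s / 4) * ramanujan_psi (exp (- 2 * pi * s)))) (range int)"
    using g f1 by (subst has_sum_reindex) (auto simp: o_def)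
  moreover have "(?f has_sum (exp (- pi * s / 4) * ramanujan_psi (exp (- 2 * pi * s)))) (range (\<lambda>n. - int n - 1))"
    using g f2 by (subst has_sum_reindex[OF inj_neg_int]) (auto simp: o_def)
  moreover have "range int \<inter> range (\<lambda>n. - int n - 1) = {}" by auto
  ultimately have "(?f has_sum (exp (- pi * s / 4) * ramanujan_psi (exp (- 2 * pi * s)) +
      exp (- pi * s / 4) * ramanujan_psi (exp (- 2 * pi * s)))) UNIV"
    unfolding UNIV_int_split by (rule has_sum_Un_disjoint)
  from has_sum_unique[OF shifted_theta_has_sum[OF s, of "1/2"] this] show ?thesis by simp
qed

lemma shifted_theta_ge_term:
  assumes "s > 0" shows "exp (- pi * s * x\<^sup>2) \<le> shifted_theta x s"
proof -
  have "((\<lambda>n::int. exp (- pi * s * (of_int n + x)\<^sup>2)) has_sum (\<Sum>n\<in>{0}. exp (- pi * s * (of_int n + x)\<^sup>2))) {0}"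
    by (rule has_sum_finite) simp
  from has_sum_mono2[OF this shifted_theta_has_sum[OF assms]] show ?thesis by simp
qed

lemma shifted_theta_pos: "s > 0 \<Longrightarrow> shifted_theta x s > 0"
  using shifted_theta_ge_term[of s x] exp_gt_zero less_le_trans by blast

text \<open>
  As \<open>(n + 1/2)\<^sup>2 \<ge> 1/4\<close>, each term loses at least the factor \<open>exp (- \<pi> (s - 1) / 4)\<close> on passing from
  parameter \<open>1\<close> to \<open>s\<close>. The bound has the true exponential rate, which the limit of the
  elliptic integrals depends on.
\<close>
lemma theta2_upper:
  assumes s: "s \<ge> 1"
  shows "theta2 s \<le> exp (- pi * (s - 1) / 4) * theta2 1"
proof (rule has_sum_mono)
  show "((\<lambda>n::int. exp (- pi * s * (of_int n + 1/2)\<^sup>2)) has_sum theta2 s) UNIV"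
    using s by (intro shifted_theta_has_sum) auto
  show "((\<lambda>n::int. exp (- pi * (s - 1) / 4) * exp (- pi * 1 * (of_int n + 1/2)\<^sup>2)) has_sum
     exp (- pi * (s - 1) / 4) * theta2 1) UNIV"
    by (intro has_sum_cmult_right shifted_theta_has_sum) auto
  fix n :: int
  have "n * (n + 1) \<ge> 0"
    by (cases "n \<ge> 0") (auto intro: mult_nonpos_nonpos)
  then have "(real_of_int n) * (real_of_int n + 1) \<ge> 0"
    by (metis of_int_0_le_iff of_int_1 of_int_add of_int_mult)
  then have "1 / 4 \<le> (real_of_int n + 1/2)\<^sup>2"
    by (simp add: power2_eq_square algebra_simps)
  then have "pi * (s - 1) * (1 / 4) \<le> pi * (s - 1) * (real_of_int n + 1/2)\<^sup>2"
    using s by (intro mult_left_mono) auto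
  moreover have "(- pi * (s - 1) / 4 + - pi * 1 * y) - (- pi * s * y) =
      pi * (s - 1) * y - pi * (s - 1) * (1 / 4)" for y
    by (simp add: field_simps)
  ultimately have "- pi * s * (of_int n + 1/2)\<^sup>2 \<le> - pi * (s - 1) / 4 + - pi * 1 * (of_int n + 1/2)\<^sup>2"
    by (metis diff_ge_0_iff_ge)
  then show "exp (- pi * s * (of_int n + 1/2)\<^sup>2) \<le> exp (- pi * (s - 1) / 4) * exp (- pi * 1 * (of_int n + 1/2)\<^sup>2)"
    unfolding exp_add[symmetric] by simp
qed

lemma theta3_upper:
  assumes s: "s \<ge> 1"
  shows "theta3 s \<le> 1 + exp (- pi * (s - 1)) * theta3 1"
proof (rule has_sum_mono)
  show "((\<lambda>n::int. exp (- pi * s * (of_int n + 0)\<^sup>2)) has_sum theta3 s) UNIV"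
    using s by (intro shifted_theta_has_sum) auto
  have "((\<lambda>n::int. if n = 0 then 1 else 0 :: real) has_sum 1) UNIV"
    using has_sum_finite_neutralI[of "{0::int}" UNIV "\<lambda>n. if n = 0 then 1 else 0 :: real" 1] by simp
  then show "((\<lambda>n::int. (if n = 0 then 1 else 0) + exp (- pi * (s - 1)) * exp (- pi * 1 * (of_int n + 0)\<^sup>2)) has_sum
     (1 + exp (- pi * (s - 1)) * theta3 1)) UNIV"
    by (intro has_sum_add has_sum_cmult_right shifted_theta_has_sum) auto
  fix n :: int
  show "exp (- pi * s * (of_int n + 0)\<^sup>2) \<le> (if n = 0 then 1 else 0) + exp (- pi * (s - 1)) * exp (- pi * 1 * (of_int n + 0)\<^sup>2)"
  proof (cases "n = 0")
    case False
    then have "1 \<le> n\<^sup>2" using zero_less_power2[of n] by linarith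
    then have "1 \<le> (real_of_int n)\<^sup>2"
      by (metis of_int_1_le_iff of_int_power)
    then have "pi * (s - 1) * 1 \<le> pi * (s - 1) * (real_of_int n)\<^sup>2"
      using s by (intro mult_left_mono) auto
    then have "- pi * s * (of_int n + 0)\<^sup>2 \<le> - pi * (s - 1) + - pi * 1 * (of_int n + 0)\<^sup>2"
      by (simp add: algebra_simps)
    then show ?thesis using False unfolding exp_add[symmetric] by simp
  qed simp
qed

section \<open>The elliptic integral of the arithmetic-geometric mean\<close>

definition agm_integrand :: "real \<Rightarrow> real \<Rightarrow> real \<Rightarrow> real" where
  "agm_integrand a b t = 1 / sqrt ((t\<^sup>2 + a\<^sup>2) * (t\<^sup>2 + b\<^sup>2))"

text \<open>
  Up to normalisation this is a complete elliptic integral of the first kind; its value is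
  \<open>\<pi> / 2\<close> divided by the arithmetic-geometric mean of \<open>a\<close> and \<open>b\<close>.
\<close>
definition agm_int :: "real \<Rightarrow> real \<Rightarrow> real" where
  "agm_int a b = integral {0<..} (agm_integrand a b)"

lemma integral_Ioi_FTC:
  fixes F f :: "real \<Rightarrow> real"
  assumes F: "\<And>x. x > a \<Longrightarrow> (F has_real_derivative f x) (at x)"
    and cont: "\<And>x. x > a \<Longrightarrow> isCont f x"
    and nonneg: "\<And>x. x > a \<Longrightarrow> f x \<ge> 0"
    and A: "(F \<longlongrightarrow> A) (at_right a)" and B: "(F \<longlongrightarrow> B) at_top"
  shows "f absolutely_integrable_on {a<..}" "integral {a<..} f = B - A"
proof -
  have lims: "((F \<circ> real_of_ereal) \<longlongrightarrow> A) (at_right (ereal a))"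
    "((F \<circ> real_of_ereal) \<longlongrightarrow> B) (at_left \<infinity>)"
    using A B by (simp_all add: ereal_tendsto_simps)
  have int: "set_integrable lborel {a<..} f" "(LBINT x=ereal a..\<infinity>. f x) = B - A"
    using interval_integral_FTC_nonneg[of "ereal a" \<infinity> F f A B] F cont nonneg lims by auto
  have "(LBINT x=ereal a..\<infinity>. f x) = (LBINT x:{a<..}. f x)"
    by (simp add: interval_lebesgue_integral_def)
  moreover note set_borel_integral_eq_integral[OF int(1)]
  ultimately show "integral {a<..} f = B - A" "f absolutely_integrable_on {a<..}"
    using int nonneg by (auto intro!: nonnegative_absolutely_integrable_1)
qed

lemma has_integral_change_one_point:
  fixes f :: "real \<Rightarrow> real"
  assumes "(f has_integral y) S" "S - T \<subseteq> {p}" "T - S \<subseteq> {p}"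
  shows "(f has_integral y) T"
proof -
  have neg: "negligible {x \<in> S - T. f x \<noteq> 0}" "negligible {x \<in> T - S. f x \<noteq> 0}"
    using assms(2,3) by (auto intro: negligible_subset[OF negligible_sing[of p]])
  show ?thesis using has_integral_spike_set_eq[OF neg] assms(1) by blast
qed

lemma sum_squares_pos: "c > 0 \<Longrightarrow> t\<^sup>2 + c\<^sup>2 > 0" for c t :: real
  by (intro add_nonneg_pos) auto

lemma agm_integrand_pos: "b > 0 \<Longrightarrow> a > 0 \<Longrightarrow> agm_integrand a b t > 0"
  unfolding agm_integrand_def by (simp add: add_nonneg_pos)

lemma continuous_agm_integrand:
  assumes "a > 0" "b > 0" shows "continuous_on S (agm_integrand a b)"
proof -
  have "(t\<^sup>2 + a\<^sup>2) * (t\<^sup>2 + b\<^sup>2) > 0" for t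
    using assms by (intro mult_pos_pos add_nonneg_pos) auto
  then show ?thesis unfolding agm_integrand_def
    by (intro continuous_intros) (metis less_irrefl real_sqrt_gt_zero)
qed

lemma agm_integrand_mono:
  assumes "a > 0" "b > 0" "a \<le> a'" "b \<le> b'"
  shows "agm_integrand a' b' t \<le> agm_integrand a b t"
  unfolding agm_integrand_def using assms
  by (intro divide_left_mono real_sqrt_le_mono mult_mono mult_pos_pos add_left_mono power_mono)
     (auto intro!: mult_pos_pos sum_squares_pos)

lemma agm_integrand_same: "agm_integrand c c t = 1 / (t\<^sup>2 + c\<^sup>2)"
  unfolding agm_integrand_def by simp

lemma agm_int_same:
  assumes c: "c > 0"
  shows "agm_integrand c c absolutely_integrable_on {0<..}" "agm_int c c = pi / (2 * c)"
proof -
  have d: "((\<lambda>t. arctan (t / c) / c) has_real_derivative agm_integrand c c t) (at t)" for t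
  proof -
    have "inverse (1 + (t / c)\<^sup>2) / c / c = 1 / (t\<^sup>2 + c\<^sup>2)"
    proof -
      have "inverse (1 + (t / c)\<^sup>2) = c\<^sup>2 / (t\<^sup>2 + c\<^sup>2)"
      proof (rule inverse_unique)
        show "(1 + (t / c)\<^sup>2) * (c\<^sup>2 / (t\<^sup>2 + c\<^sup>2)) = 1"
          using c sum_squares_pos[OF c, of t] by (simp add: power_divide distrib_right add_divide_distrib[symmetric] add.commute)
      qed
      then show ?thesis using c by (simp add: power2_eq_square)
    qed
    moreover have "((\<lambda>t. arctan (t / c) / c) has_real_derivative inverse (1 + (t / c)\<^sup>2) / c / c) (at t)"
      using c by (auto intro!: derivative_eq_intros simp: divide_simps)
    ultimately show ?thesis by (simp only: agm_integrand_same)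
  qed
  have cont: "isCont (agm_integrand c c) t" for t
    using continuous_agm_integrand[OF c c, of UNIV] by (simp add: continuous_on_eq_continuous_at)
  have l0: "((\<lambda>t. arctan (t / c) / c) \<longlongrightarrow> arctan (0 / c) / c) (at_right 0)"
    using c by (intro tendsto_intros) auto
  have l1: "((\<lambda>t. arctan (t / c) / c) \<longlongrightarrow> (pi / 2) / c) at_top"
    using c by (intro tendsto_intros filterlim_compose[OF tendsto_arctan_at_top]) (use c in \<open>real_asymp | simp\<close>)+
  note FTC = integral_Ioi_FTC[OF d cont less_imp_le[OF agm_integrand_pos[OF c c]] l0 l1]
  show "agm_integrand c c absolutely_integrable_on {0<..}" by (rule FTC(1))
  show "agm_int c c = pi / (2 * c)" using FTC(2) by (simp add: agm_int_def)
qed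

lemma agm_int_integrable:
  assumes a: "a > 0" and b: "b > 0"
  shows "agm_integrand a b absolutely_integrable_on {0<..}"
proof (rule measurable_bounded_by_integrable_imp_absolutely_integrable)
  show "agm_integrand a b \<in> borel_measurable (lebesgue_on {0<..})"
    by (intro continuous_imp_measurable_on_sets_lebesgue continuous_agm_integrand a b) auto
  have "min a b > 0" using a b by auto
  then show "agm_integrand (min a b) (min a b) integrable_on {0<..}"
    using agm_int_same(1) set_lebesgue_integral_eq_integral(1) by blast
  show "norm (agm_integrand a b t) \<le> agm_integrand (min a b) (min a b) t" if "t \<in> {0<..}" for t
    using agm_integrand_mono[of "min a b" "min a b" a b t] agm_integrand_pos[OF b a, of t] a b by simp
qed auto

lemma agm_int_integrable_on:
  assumes "a > 0" "b > 0"
  shows "agm_integrand a b integrable_on {0<..}"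
  using agm_int_integrable[OF assms] set_lebesgue_integral_eq_integral(1) by blast

lemma agm_int_mono:
  assumes "a > 0" "b > 0" "a \<le> a'" "b \<le> b'"
  shows "agm_int a' b' \<le> agm_int a b"
  unfolding agm_int_def using assms
  by (intro integral_le agm_int_integrable_on agm_integrand_mono) auto

text \<open>
  Strictness needs a uniform gap between the integrands somewhere; compactness provides one on \<open>{1..2}\<close>.
\<close>
lemma agm_int_strict_mono:
  assumes a: "a > 0" and b: "b > 0" and bc: "b < c"
  shows "agm_int a c < agm_int a b"
proof -
  define D where "D = (\<lambda>t. agm_integrand a b t - agm_integrand a c t)"
  have c: "c > 0" using b bc by simp
  have Dpos: "D t > 0" for t
  proof -
    have "(t\<^sup>2 + a\<^sup>2) * (t\<^sup>2 + b\<^sup>2) < (t\<^sup>2 + a\<^sup>2) * (t\<^sup>2 + c\<^sup>2)"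
      using a b bc by (intro mult_strict_left_mono add_strict_left_mono power_strict_mono add_nonneg_pos) auto
    moreover have "(t\<^sup>2 + a\<^sup>2) * (t\<^sup>2 + b\<^sup>2) > 0"
      using a b by (intro mult_pos_pos add_nonneg_pos) auto
    ultimately show ?thesis unfolding D_def agm_integrand_def
      by (auto intro!: divide_strict_left_mono)
  qed
  have cont: "continuous_on {1..2} D"
    unfolding D_def by (intro continuous_intros continuous_agm_integrand a b c)
  then obtain u where u: "u \<in> {1..2}" "\<And>t. t \<in> {1..2} \<Longrightarrow> D u \<le> D t"
    using continuous_attains_inf[of "{1..2::real}" D] by auto
  have Dint: "D integrable_on {0<..}"
    unfolding D_def by (intro integrable_diff agm_int_integrable_on a b c)
  have "0 < integral {1..2::real} (\<lambda>_. D u)" using Dpos[of u] by simp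
  also have "\<dots> \<le> integral {1..2} D"
    using u cont by (intro integral_le integrable_continuous_interval) auto
  also have "\<dots> \<le> integral {0<..} D"
    using cont Dint Dpos by (intro integral_subset_le integrable_continuous_interval) (auto intro: less_imp_le)
  also have "\<dots> = agm_int a b - agm_int a c"
    unfolding D_def agm_int_def by (intro Henstock_Kurzweil_Integration.integral_diff agm_int_integrable_on a b c)
  finally show ?thesis by simp
qed

lemma agm_int_scale:
  assumes l: "l > 0" and a: "a > 0" and b: "b > 0"
  shows "agm_int (l * a) (l * b) = agm_int a b / l"
proof -
  have img: "(\<lambda>t. l * t) ` {0<..} = {0<..}"
  proof -
    have "x \<in> (\<lambda>t. l * t) ` {0<..}" if "x > 0" for x
      using that l by (intro image_eqI[of _ _ "x / l"]) auto
    then show ?thesis using l by auto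
  qed
  have eq: "\<bar>l\<bar> * agm_integrand (l * a) (l * b) (l * t) = (1 / l) * agm_integrand a b t" for t
  proof -
    have "((l * t)\<^sup>2 + (l * a)\<^sup>2) * ((l * t)\<^sup>2 + (l * b)\<^sup>2) = (l\<^sup>2)\<^sup>2 * ((t\<^sup>2 + a\<^sup>2) * (t\<^sup>2 + b\<^sup>2))"
      by algebra
    then have "sqrt (((l * t)\<^sup>2 + (l * a)\<^sup>2) * ((l * t)\<^sup>2 + (l * b)\<^sup>2)) = l\<^sup>2 * sqrt ((t\<^sup>2 + a\<^sup>2) * (t\<^sup>2 + b\<^sup>2))"
      by (simp only: real_sqrt_mult[of "(l\<^sup>2)\<^sup>2"] real_sqrt_abs) simp
    then show ?thesis using l unfolding agm_integrand_def by (simp add: power2_eq_square)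
  qed
  have "integral {0<..} (\<lambda>t. \<bar>l\<bar> * agm_integrand (l * a) (l * b) (l * t)) = agm_int (l * a) (l * b)"
    using has_absolute_integral_change_of_variables_1'[of "{0<..}" "\<lambda>t. l * t" "\<lambda>_. l" "agm_integrand (l * a) (l * b)"]
      agm_int_integrable[of "l * a" "l * b"] l a b unfolding img agm_int_def
    by (auto intro!: derivative_eq_intros simp: inj_on_def)
  then show ?thesis unfolding eq by (simp add: agm_int_def)
qed

lemma integral_even_UNIV:
  fixes f :: "real \<Rightarrow> real"
  assumes f: "f absolutely_integrable_on {0<..}" and even: "\<And>t. f (- t) = f t"
  shows "integral UNIV f = 2 * integral {0<..} f"
proof -
  have img: "uminus ` {0<..} = {..<0::real}"
    by (auto simp: image_iff intro: bexI[of _ "- x" for x])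
  have "f absolutely_integrable_on {..<0}" "integral {..<0} f = integral {0<..} f"
  proof -
    have "(uminus has_real_derivative - 1) (at x within {0<..})" for x :: real
      by (rule DERIV_minus[OF DERIV_ident])
    then show "f absolutely_integrable_on {..<0}" "integral {..<0} f = integral {0<..} f"
      using has_absolute_integral_change_of_variables_1'[of "{0<..}" uminus "\<lambda>_. -1" f "integral {0<..} f"] f
      unfolding img by (auto simp: even inj_on_def)
  qed
  moreover have "{..<0} \<inter> {0<..} = ({} :: real set)" by auto
  ultimately have "(f has_integral (integral {0<..} f + integral {0<..} f)) ({..<0} \<union> {0<..})"
    using f by (intro has_integral_Un)
      (auto simp: has_integral_iff intro: set_lebesgue_integral_eq_integral)
  then have "(f has_integral (integral {0<..} f + integral {0<..} f)) UNIV"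
    by (rule has_integral_change_one_point[where p = 0]) auto
  then show ?thesis by (simp add: has_integral_iff)
qed

text \<open>
  Gauss's substitution \<open>u = (t - a b / t) / 2\<close> maps the positive half-line increasingly onto the whole
  line. Both \<open>u\<^sup>2 + a b\<close> and \<open>u\<^sup>2 + ((a + b) / 2)\<^sup>2\<close> become products in \<open>t\<close>, and the transformed
  integrand is twice the original one; the factor two is absorbed by the evenness of the integrand
  in \<open>u\<close>.
\<close>
lemma agm_int_landen:
  assumes a: "a > 0" and b: "b > 0"
  shows "agm_int ((a + b) / 2) (sqrt (a * b)) = agm_int a b"
proof -
  define A where "A = (a + b) / 2"
  define g where "g = sqrt (a * b)"
  have Apos: "A > 0" and gpos: "g > 0" and g2: "g\<^sup>2 = a * b"
    using a b by (auto simp: A_def g_def)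
  define \<phi> where "\<phi> = (\<lambda>t. (t - a * b / t) / 2)"
  define \<phi>' where "\<phi>' = (\<lambda>t. (1 + a * b / t\<^sup>2) / 2)"
  have der: "(\<phi> has_real_derivative \<phi>' t) (at t within {0<..})" if "t > 0" for t
    unfolding \<phi>_def \<phi>'_def using that
    by (auto intro!: derivative_eq_intros simp: power2_eq_square)
  have inj: "inj_on \<phi> {0<..}"
  proof (rule strict_mono_on_imp_inj_on, rule strict_mono_onI)
    fix r t :: real assume "r \<in> {0<..}" "t \<in> {0<..}" "r < t"
    then have "a * b / t < a * b / r" using a b by (intro divide_strict_left_mono) auto
    then show "\<phi> r < \<phi> t" unfolding \<phi>_def using \<open>r < t\<close>
      by (intro divide_strict_right_mono) linarith+
  qed
  have img: "\<phi> ` {0<..} = UNIV"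
  proof -
    have "u \<in> \<phi> ` {0<..}" for u
    proof (rule image_eqI)
      \<comment> \<open>the positive root of \<open>t\<^sup>2 - 2 u t - a b = 0\<close>\<close>
      define t where "t = u + sqrt (u\<^sup>2 + a * b)"
      have "\<bar>u\<bar> < sqrt (u\<^sup>2 + a * b)"
        using a b by (intro real_less_rsqrt) auto
      then have t: "t > 0" unfolding t_def by linarith
      moreover have "(t - u)\<^sup>2 = u\<^sup>2 + a * b" unfolding t_def using a b by simp
      ultimately show "u = \<phi> t" unfolding \<phi>_def by (simp add: field_simps power2_eq_square)
      show "t \<in> {0<..}" using t by simp
    qed
    then show ?thesis by auto
  qed
  have eq: "\<bar>\<phi>' t\<bar> * agm_integrand A g (\<phi> t) = 2 * agm_integrand a b t" if t: "t > 0" for t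
  proof -
    define p where "p = (t + a * b / t) / 2"
    have p: "p > 0" unfolding p_def using a b t by (intro divide_pos_pos add_pos_pos) auto
    have 1: "(\<phi> t)\<^sup>2 + g\<^sup>2 = p\<^sup>2"
      unfolding \<phi>_def g2 p_def using t by (simp add: field_simps power2_eq_square)
    have 2: "(\<phi> t)\<^sup>2 + A\<^sup>2 = ((t\<^sup>2 + a\<^sup>2) * (t\<^sup>2 + b\<^sup>2)) / (2 * t)\<^sup>2"
      unfolding \<phi>_def A_def using t by (simp add: field_simps power2_eq_square)
    have "sqrt (((\<phi> t)\<^sup>2 + A\<^sup>2) * ((\<phi> t)\<^sup>2 + g\<^sup>2)) = sqrt ((t\<^sup>2 + a\<^sup>2) * (t\<^sup>2 + b\<^sup>2)) / (2 * t) * p"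
      unfolding 1 2 real_sqrt_mult real_sqrt_divide real_sqrt_abs using t p by simp
    moreover have "\<phi>' t = p / t" unfolding \<phi>'_def p_def using t by (simp add: field_simps power2_eq_square)
    ultimately show ?thesis using t p unfolding agm_integrand_def by simp
  qed
  have "(\<lambda>t. \<bar>\<phi>' t\<bar> * agm_integrand A g (\<phi> t)) absolutely_integrable_on {0<..} \<longleftrightarrow>
      (\<lambda>t. 2 * agm_integrand a b t) absolutely_integrable_on {0<..}"
    by (rule set_integrable_cong) (auto simp: eq)
  then have ai: "(\<lambda>t. \<bar>\<phi>' t\<bar> * agm_integrand A g (\<phi> t)) absolutely_integrable_on {0<..}"
    using agm_int_integrable[OF a b] by simp
  have "integral {0<..} (\<lambda>t. \<bar>\<phi>' t\<bar> * agm_integrand A g (\<phi> t)) = integral {0<..} (\<lambda>t. 2 * agm_integrand a b t)"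
    by (rule Henstock_Kurzweil_Integration.integral_cong) (simp add: eq)
  then have "integral {0<..} (\<lambda>t. \<bar>\<phi>' t\<bar> * agm_integrand A g (\<phi> t)) = 2 * agm_int a b"
    by (simp add: agm_int_def)
  then have "integral UNIV (agm_integrand A g) = 2 * agm_int a b"
    using has_absolute_integral_change_of_variables_1'[of "{0<..}" \<phi> \<phi>' "agm_integrand A g" "2 * agm_int a b"]
      der inj ai unfolding img by auto
  moreover have "integral UNIV (agm_integrand A g) = 2 * agm_int A g"
    unfolding agm_int_def by (intro integral_even_UNIV agm_int_integrable Apos gpos) (simp add: agm_integrand_def)
  ultimately show ?thesis by (simp add: A_def g_def)
qed

text \<open>
  Replacing \<open>t\<^sup>2 + a\<^sup>2\<close> by the larger \<open>(t + a)\<^sup>2\<close>, and likewise for \<open>c\<close>, leaves a rational function. Together with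
  the upper bound below this captures the logarithmic growth as \<open>c\<close> tends to \<open>0\<close>.
\<close>
lemma agm_int_lower_bound:
  assumes c: "c > 0" and a: "a > c"
  shows "ln (a / c) / (a - c) \<le> agm_int a c"
proof -
  define F where "F = (\<lambda>t. ln ((t + c) / (t + a)) / (a - c))"
  define f where "f = (\<lambda>t. 1 / ((t + a) * (t + c)))"
  have d: "(F has_real_derivative f t) (at t)" if "t > 0" for t
    unfolding F_def f_def using that c a
    by (auto intro!: derivative_eq_intros simp: divide_simps)
  have cont: "isCont f t" if "t > 0" for t
    unfolding f_def using that c a by (intro continuous_intros) auto
  have l0: "(F \<longlongrightarrow> ln ((0 + c) / (0 + a)) / (a - c)) (at_right 0)"
    unfolding F_def using c a by (intro tendsto_intros) auto
  have l1: "(F \<longlongrightarrow> 0) at_top"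
    unfolding F_def using c a by real_asymp
  have I: "f absolutely_integrable_on {0<..}" "integral {0<..} f = 0 - ln ((0 + c) / (0 + a)) / (a - c)"
    by (rule integral_Ioi_FTC[of 0 F f, OF d cont _ l0 l1]; use c a in \<open>simp add: f_def\<close>)+
  have "ln (a / c) / (a - c) = integral {0<..} f"
    using I(2) c a by (simp add: ln_div diff_divide_distrib)
  also have "\<dots> \<le> agm_int a c" unfolding agm_int_def
  proof (rule integral_le)
    show "f integrable_on {0<..}" using I(1) set_lebesgue_integral_eq_integral(1) by blast
    show "agm_integrand a c integrable_on {0<..}" using c a by (intro agm_int_integrable_on) auto
    fix t :: real assume t: "t \<in> {0<..}"
    have "(t\<^sup>2 + a\<^sup>2) * (t\<^sup>2 + c\<^sup>2) \<le> (t + a)\<^sup>2 * (t + c)\<^sup>2"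
      using t c a by (intro mult_mono) (auto simp: power2_sum)
    then have "sqrt ((t\<^sup>2 + a\<^sup>2) * (t\<^sup>2 + c\<^sup>2)) \<le> (t + a) * (t + c)"
      using t c a by (intro real_le_lsqrt) (auto simp: power_mult_distrib)
    moreover have "(t\<^sup>2 + a\<^sup>2) * (t\<^sup>2 + c\<^sup>2) > 0"
      using c a by (intro mult_pos_pos add_nonneg_pos) auto
    ultimately show "f t \<le> agm_integrand a c t"
      unfolding f_def agm_integrand_def using t c a by (intro divide_left_mono) auto
  qed
  finally show ?thesis .
qed

text \<open>
  On \<open>{0..1}\<close> the factor \<open>t\<^sup>2 + 1\<close> may be dropped, which leaves the derivative of
  \<open>ln (t + sqrt (t\<^sup>2 + c\<^sup>2))\<close>; beyond \<open>1\<close> the integrand is at most \<open>1 / t\<^sup>2\<close>. Only the coefficient of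
  \<open>ln (1 / c)\<close> matters later, and the additive constant is generous.
\<close>
lemma agm_int_upper_bound:
  assumes c: "c > 0" and c1: "c < 1"
  shows "agm_int 1 c \<le> ln (1 / c) + 3"
proof -
  have int1: "agm_integrand 1 c integrable_on {0..1}"
    using c by (intro integrable_continuous_interval continuous_agm_integrand) auto
  note sq = sum_squares_pos[OF c]
  have "((\<lambda>t. 1 / sqrt (t\<^sup>2 + c\<^sup>2)) has_integral (ln (1 + sqrt (1\<^sup>2 + c\<^sup>2)) - ln (0 + sqrt (0\<^sup>2 + c\<^sup>2)))) {0..1}"
  proof (rule fundamental_theorem_of_calculus)
    fix t :: real assume t: "t \<in> {0..1}"
    have s: "sqrt (t\<^sup>2 + c\<^sup>2) > 0" using sq[of t] by simp
    have "((\<lambda>t. ln (t + sqrt (t\<^sup>2 + c\<^sup>2))) has_real_derivative 1 / sqrt (t\<^sup>2 + c\<^sup>2)) (at t within {0..1})"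
    proof -
      have "t + sqrt (t\<^sup>2 + c\<^sup>2) > 0" using s t by (intro add_nonneg_pos) auto
      moreover have "(1 + t / sqrt (t\<^sup>2 + c\<^sup>2)) / (t + sqrt (t\<^sup>2 + c\<^sup>2)) = 1 / sqrt (t\<^sup>2 + c\<^sup>2)"
        using s \<open>t + sqrt (t\<^sup>2 + c\<^sup>2) > 0\<close> by (simp add: divide_simps)
      ultimately show ?thesis using s sq[of t]
        by (auto intro!: derivative_eq_intros simp: divide_simps)
    qed
    then show "((\<lambda>t. ln (t + sqrt (t\<^sup>2 + c\<^sup>2))) has_vector_derivative 1 / sqrt (t\<^sup>2 + c\<^sup>2)) (at t within {0..1})"
      by (simp add: has_real_derivative_iff_has_vector_derivative)
  qed simp
  then have m1: "(\<lambda>t. 1 / sqrt (t\<^sup>2 + c\<^sup>2)) integrable_on {0..1}"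
    "integral {0..1} (\<lambda>t. 1 / sqrt (t\<^sup>2 + c\<^sup>2)) = ln (1 + sqrt (1 + c\<^sup>2)) - ln c"
    using c by (auto simp: has_integral_iff)
  have b1: "integral {0..1} (agm_integrand 1 c) \<le> ln (1 + sqrt (1 + c\<^sup>2)) - ln c"
    unfolding m1(2)[symmetric]
  proof (rule integral_le[OF int1 m1(1)])
    fix t :: real
    have "1 * (t\<^sup>2 + c\<^sup>2) \<le> (t\<^sup>2 + 1\<^sup>2) * (t\<^sup>2 + c\<^sup>2)"
      using sq[of t] by (intro mult_right_mono) auto
    then show "agm_integrand 1 c t \<le> 1 / sqrt (t\<^sup>2 + c\<^sup>2)"
      unfolding agm_integrand_def using sq[of t]
      by (intro divide_left_mono) (auto intro!: mult_pos_pos add_nonneg_pos)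
  qed
  have d: "((\<lambda>t. - 1 / t) has_real_derivative 1 / t\<^sup>2) (at t)" if "t > 1" for t :: real
    using that by (auto intro!: derivative_eq_intros simp: power2_eq_square)
  have l0: "((\<lambda>t::real. - 1 / t) \<longlongrightarrow> - 1 / 1) (at_right 1)" by (intro tendsto_intros) auto
  have l1: "((\<lambda>t::real. - 1 / t) \<longlongrightarrow> 0) at_top" by real_asymp
  have I: "(\<lambda>t::real. 1 / t\<^sup>2) absolutely_integrable_on {1<..}" "integral {1<..} (\<lambda>t::real. 1 / t\<^sup>2) = 0 - (- 1 / 1)"
    by (rule integral_Ioi_FTC[OF d _ _ l0 l1]; (intro continuous_intros)?; simp)+
  have int2: "agm_integrand 1 c integrable_on {1<..}"
    using set_integrable_subset[OF agm_int_integrable[of 1 c], of "{1<..}"] c set_lebesgue_integral_eq_integral(1) by force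
  have b2: "integral {1<..} (agm_integrand 1 c) \<le> 1"
  proof -
    have "integral {1<..} (agm_integrand 1 c) \<le> integral {1<..} (\<lambda>t::real. 1 / t\<^sup>2)"
    proof (rule integral_le[OF int2])
      show "(\<lambda>t::real. 1 / t\<^sup>2) integrable_on {1<..}" using I(1) set_lebesgue_integral_eq_integral(1) by blast
      fix t :: real assume t: "t \<in> {1<..}"
      have "t\<^sup>2 * t\<^sup>2 \<le> (t\<^sup>2 + 1\<^sup>2) * (t\<^sup>2 + c\<^sup>2)" by (intro mult_mono) auto
      then have "t\<^sup>2 \<le> sqrt ((t\<^sup>2 + 1\<^sup>2) * (t\<^sup>2 + c\<^sup>2))"
        by (intro real_le_rsqrt) (simp add: power2_eq_square)
      then show "agm_integrand 1 c t \<le> 1 / t\<^sup>2"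
        unfolding agm_integrand_def using t by (intro divide_left_mono) (auto intro!: mult_pos_pos add_nonneg_pos sq)
    qed
    then show ?thesis using I(2) by simp
  qed
  have disj: "{0..1} \<inter> {1<..} = ({} :: real set)" by auto
  have "(agm_integrand 1 c has_integral (integral {0..1} (agm_integrand 1 c) + integral {1<..} (agm_integrand 1 c))) ({0..1} \<union> {1<..})"
    using int1 int2 disj by (intro has_integral_Un) auto
  then have "(agm_integrand 1 c has_integral (integral {0..1} (agm_integrand 1 c) + integral {1<..} (agm_integrand 1 c))) {0<..}"
    by (rule has_integral_change_one_point[where p = 0]) auto
  then have "agm_int 1 c = integral {0..1} (agm_integrand 1 c) + integral {1<..} (agm_integrand 1 c)"
    by (simp add: agm_int_def has_integral_iff)
  moreover have "ln (1 + sqrt (1 + c\<^sup>2)) \<le> 2"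
  proof -
    have "sqrt (1 + c\<^sup>2) \<le> 2" using c c1 power_le_one[of c 2] by (intro real_le_lsqrt) auto
    then show ?thesis using ln_le_minus_one[of "1 + sqrt (1 + c\<^sup>2)"] by (simp add: add_pos_nonneg)
  qed
  ultimately show ?thesis using b1 b2 c by (simp add: ln_div)
qed

text \<open>
  The substitution \<open>x = 1 / (1 + t\<^sup>2)\<^sup>2\<close> turns the Beta integral with parameters \<open>1/4\<close> and \<open>1/2\<close> into this integral.
\<close>
lemma agm_int_lemniscate: "agm_int (sqrt 2) 1 = Beta (1/4) (1/2) / 4"
proof -
  define g where "g = (\<lambda>t::real. 1 / (1 + t\<^sup>2)\<^sup>2)"
  define g' where "g' = (\<lambda>t::real. - 4 * t / (1 + t\<^sup>2) ^ 3)"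
  define f where "f = (\<lambda>x::real. x powr (1/4 - 1) * (1 - x) powr (1/2 - 1))"
  have pos: "1 + t\<^sup>2 > 0" for t :: real by (rule add_pos_nonneg) auto
  have der: "(g has_real_derivative g' t) (at t within {0<..})" for t
    unfolding g_def g'_def using pos[of t]
    by (auto intro!: derivative_eq_intros simp: divide_simps) (simp add: power_numeral_reduce)
  have inj: "inj_on g {0<..}"
    unfolding g_def using pos by (intro inj_onI) (simp add: power2_eq_iff_nonneg)
  have img: "g ` {0<..} = {0<..<1}"
  proof (intro equalityI subsetI)
    fix x assume "x \<in> g ` {0<..}"
    then obtain t where t: "t > 0" "x = g t" by auto
    then have "(1 + t\<^sup>2)\<^sup>2 > 1" by (intro one_less_power) auto
    then show "x \<in> {0<..<1}" using t pos[of t] divide_less_eq_1_pos[of "(1 + t\<^sup>2)\<^sup>2" 1]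
      unfolding g_def by simp
  next
    fix x :: real assume x: "x \<in> {0<..<1}"
    define t where "t = sqrt (1 / sqrt x - 1)"
    have "sqrt x < 1" using x by simp
    then have "1 / sqrt x - 1 > 0" using x by simp
    then have "t > 0" "t\<^sup>2 = 1 / sqrt x - 1" unfolding t_def by auto
    then have "x = g t" unfolding g_def using x by (simp add: power_divide)
    then show "x \<in> g ` {0<..}" using \<open>t > 0\<close> by auto
  qed
  have eq: "\<bar>g' t\<bar> * f (g t) = 4 * agm_integrand (sqrt 2) 1 t" if t: "t > 0" for t
  proof -
    define w where "w = 1 + t\<^sup>2"
    have w: "w > 1" unfolding w_def using t by simp
    have 1: "g t powr (1/4 - 1) = w * sqrt w"
    proof -
      have "g t = w powr (- 2)" unfolding g_def w_def[symmetric] using w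
        by (simp add: powr_minus_divide)
      then have "g t powr (1/4 - 1) = w powr (1 + 1/2)" using w by (simp add: powr_powr)
      also have "\<dots> = w * sqrt w" using w by (subst powr_add) (simp add: powr_half_sqrt)
      finally show ?thesis .
    qed
    have e: "1 - g t = (t / w)\<^sup>2 * (t\<^sup>2 + 2)"
      unfolding g_def w_def[symmetric] using w by (simp add: power_divide divide_simps) (simp add: w_def power2_eq_square algebra_simps)
    have 2: "(1 - g t) powr (1/2 - 1) = w / (t * sqrt (t\<^sup>2 + 2))"
    proof -
      have "(1 - g t) powr (1/2 - 1) = 1 / sqrt (1 - g t)"
      proof -
        have "1 - g t \<ge> 0" unfolding e using t w by simp
        then show ?thesis by (simp add: powr_minus_divide powr_half_sqrt)
      qed
      also have "\<dots> = w / (t * sqrt (t\<^sup>2 + 2))" unfolding e using t w by (simp add: real_sqrt_mult)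
      finally show ?thesis .
    qed
    have 3: "\<bar>g' t\<bar> = 4 * t / w ^ 3" unfolding g'_def w_def[symmetric] using t w by simp
    have 4: "agm_integrand (sqrt 2) 1 t = 1 / (sqrt (t\<^sup>2 + 2) * sqrt w)"
      unfolding agm_integrand_def w_def by (simp add: real_sqrt_mult add.commute)
    have "sqrt w * sqrt w = w" using w by simp
    then show ?thesis unfolding f_def 1 2 3 4 using t w
      by (simp add: divide_simps power3_eq_cube)
  qed
  have "(f has_integral Beta (1/4) (1/2)) {0<..<1}"
    unfolding f_def using has_integral_Beta_real[of "1/4" "1/2"]
    by (simp add: has_integral_Icc_iff_Ioo)
  then have "integral {0<..<1} f = Beta (1/4) (1/2)" "f absolutely_integrable_on {0<..<1}"
    by (auto simp: has_integral_iff f_def intro!: nonnegative_absolutely_integrable_1)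
  then have "integral {0<..} (\<lambda>t. \<bar>g' t\<bar> * f (g t)) = Beta (1/4) (1/2)"
    using has_absolute_integral_change_of_variables_1'[of "{0<..}" g g' f "Beta (1/4) (1/2)"]
      der inj unfolding img by auto
  also have "integral {0<..} (\<lambda>t. \<bar>g' t\<bar> * f (g t)) = integral {0<..} (\<lambda>t. 4 * agm_integrand (sqrt 2) 1 t)"
    by (rule Henstock_Kurzweil_Integration.integral_cong) (simp add: eq)
  finally show ?thesis by (simp add: agm_int_def)
qed

section \<open>Theta values at the self-dual point\<close>

text \<open>
  These are \<open>\<vartheta>\<^sub>3\<^sup>2\<close>, \<open>\<vartheta>\<^sub>4\<^sup>2\<close> and \<open>\<vartheta>\<^sub>2\<^sup>2\<close>. The second is given by the duplication formula
  \<open>\<vartheta>\<^sub>4(q)\<^sup>2 = \<vartheta>\<^sub>3(q\<^sup>2)\<^sup>2 - \<vartheta>\<^sub>2(q\<^sup>2)\<^sup>2\<close>, so that no alternating series has to be introduced; its positivity is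
  then a statement to prove.
\<close>
definition theta3sq :: "real \<Rightarrow> real" where "theta3sq s = (theta3 s)\<^sup>2"
definition theta4sq :: "real \<Rightarrow> real" where "theta4sq s = (theta3 (2 * s))\<^sup>2 - (theta2 (2 * s))\<^sup>2"
definition theta2sq :: "real \<Rightarrow> real" where "theta2sq s = (theta2 s)\<^sup>2"

lemma theta3sq_pos: "s > 0 \<Longrightarrow> theta3sq s > 0"
  and theta2sq_pos: "s > 0 \<Longrightarrow> theta2sq s > 0"
  unfolding theta3sq_def theta2sq_def by (intro zero_less_power shifted_theta_pos; simp)+

lemma theta3sq_double: "s > 0 \<Longrightarrow> theta3sq (2 * s) = (theta3sq s + theta4sq s) / 2"
  using theta3_squared_double[of s] by (simp add: theta3sq_def theta4sq_def)

text \<open>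
  Jacobi's quartic identity \<open>\<vartheta>\<^sub>3\<^sup>4 = \<vartheta>\<^sub>4\<^sup>4 + \<vartheta>\<^sub>2\<^sup>4\<close>: in terms of \<open>X = \<vartheta>\<^sub>3(q\<^sup>2)\<close> and \<open>Y = \<vartheta>\<^sub>2(q\<^sup>2)\<close> it reads
  \<open>(X\<^sup>2 + Y\<^sup>2)\<^sup>2 = (X\<^sup>2 - Y\<^sup>2)\<^sup>2 + (2 X Y)\<^sup>2\<close>.
\<close>
lemma jacobi_quartic_identity:
  assumes "s > 0" shows "(theta3sq s)\<^sup>2 = (theta4sq s)\<^sup>2 + (theta2sq s)\<^sup>2"
  unfolding theta3sq_def theta4sq_def theta2sq_def theta3_squared_double[OF assms] theta2_squared_double[OF assms]
  by algebra

text \<open>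
  Together with the preceding duplication of \<open>\<vartheta>\<^sub>3\<^sup>2\<close> this says that doubling \<open>s\<close> performs one step of the
  arithmetic-geometric mean on the pair \<open>(\<vartheta>\<^sub>3\<^sup>2, \<vartheta>\<^sub>4\<^sup>2)\<close>.
\<close>
lemma theta4sq_double:
  assumes s: "s > 0" shows "(theta4sq (2 * s))\<^sup>2 = theta3sq s * theta4sq s"
proof -
  have "(theta4sq (2 * s))\<^sup>2 = (theta3sq (2 * s))\<^sup>2 - (theta2sq (2 * s))\<^sup>2"
    using jacobi_quartic_identity[of "2 * s"] s by simp
  also have "\<dots> = theta3sq s * theta4sq s"
    unfolding theta3sq_def theta4sq_def theta2sq_def theta3_squared_double[OF s] by algebra
  finally show ?thesis .
qed

text \<open>
  For the pair \<open>(\<vartheta>\<^sub>3\<^sup>2, \<vartheta>\<^sub>2\<^sup>2)\<close> the same step runs backwards: up to a factor two, halving \<open>s\<close> performs it.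
\<close>
lemma theta3sq_theta2sq_halve:
  assumes s: "s > 0"
  shows "theta3sq s = theta3sq (2 * s) + theta2sq (2 * s)"
    and "(theta2sq s)\<^sup>2 = 4 * theta3sq (2 * s) * theta2sq (2 * s)"
  unfolding theta3sq_def theta2sq_def theta3_squared_double[OF s] theta2_squared_double[OF s] by algebra+

lemma exp_doubling_tendsto_0:
  assumes "l > 0" shows "(\<lambda>n. exp (- l * (2 ^ n - 1)) :: real) \<longlonglongrightarrow> 0"
proof -
  have "filterlim (\<lambda>n. 2 ^ n - 1 :: real) at_top sequentially" by real_asymp
  then have "filterlim (\<lambda>n. - l * (2 ^ n - 1)) at_bot sequentially"
    using assms by (intro filterlim_tendsto_neg_mult_at_bot[OF tendsto_const]) auto
  then show ?thesis by (rule filterlim_compose[OF exp_at_bot])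
qed

lemma two_power_ge_1: "(1::real) \<le> 2 ^ n" by simp

lemma theta3_tendsto: "(\<lambda>n. theta3 (2 ^ n)) \<longlonglongrightarrow> 1"
proof (rule tendsto_sandwich)
  show "\<forall>\<^sub>F n in sequentially. 1 \<le> theta3 (2 ^ n)"
    using shifted_theta_ge_term[of _ 0] by (intro always_eventually) (simp add: allI)
  show "\<forall>\<^sub>F n in sequentially. theta3 (2 ^ n) \<le> 1 + exp (- pi * (2 ^ n - 1)) * theta3 1"
    by (intro always_eventually allI theta3_upper) simp
  have "(\<lambda>n. 1 + exp (- pi * (2 ^ n - 1)) * theta3 1) \<longlonglongrightarrow> 1 + 0 * theta3 1"
    by (intro tendsto_intros exp_doubling_tendsto_0) simp
  then show "(\<lambda>n. 1 + exp (- pi * (2 ^ n - 1)) * theta3 1) \<longlonglongrightarrow> 1" by simp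
qed simp

lemma theta2_tendsto: "(\<lambda>n. theta2 (2 ^ n)) \<longlonglongrightarrow> 0"
proof (rule tendsto_sandwich)
  show "\<forall>\<^sub>F n in sequentially. 0 \<le> theta2 (2 ^ n)"
    by (intro always_eventually allI less_imp_le shifted_theta_pos) simp
  show "\<forall>\<^sub>F n in sequentially. theta2 (2 ^ n) \<le> exp (- (pi / 4) * (2 ^ n - 1)) * theta2 1"
    using theta2_upper[OF two_power_ge_1] by (intro always_eventually allI) simp
  have "(\<lambda>n. exp (- (pi / 4) * (2 ^ n - 1)) * theta2 1) \<longlonglongrightarrow> 0 * theta2 1"
    by (intro tendsto_intros exp_doubling_tendsto_0) simp
  then show "(\<lambda>n. exp (- (pi / 4) * (2 ^ n - 1)) * theta2 1) \<longlonglongrightarrow> 0" by simp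
qed simp

lemma theta3sq_tendsto: "(\<lambda>n. theta3sq (2 ^ n)) \<longlonglongrightarrow> 1"
  unfolding theta3sq_def using tendsto_power[OF theta3_tendsto, of 2] by simp

lemma theta2sq_tendsto: "(\<lambda>n. theta2sq (2 ^ n)) \<longlonglongrightarrow> 0"
  unfolding theta2sq_def using tendsto_power[OF theta2_tendsto, of 2] by simp

lemma theta4sq_tendsto: "(\<lambda>n. theta4sq (2 ^ n)) \<longlonglongrightarrow> 1"
proof -
  have "(\<lambda>n. (theta3 (2 ^ Suc n))\<^sup>2 - (theta2 (2 ^ Suc n))\<^sup>2) \<longlonglongrightarrow> 1\<^sup>2 - 0\<^sup>2"
    by (intro tendsto_diff tendsto_power LIMSEQ_Suc theta3_tendsto theta2_tendsto)
  then show ?thesis by (simp add: theta4sq_def)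
qed

text \<open>
  The sign propagates downwards: for large \<open>n\<close> the quantity is close to \<open>1\<close>, and its value at \<open>s\<close> is its squared
  value at \<open>2 s\<close> divided by the positive \<open>\<vartheta>\<^sub>3\<^sup>2\<close>.
\<close>
lemma theta4sq_pos: "theta4sq (2 ^ n) > 0"
proof -
  have step: "theta4sq s > 0" if "s > 0" "theta4sq (2 * s) > 0" for s
  proof -
    have "theta3sq s * theta4sq s > 0"
      using theta4sq_double[OF that(1)] that(2) by (metis zero_less_power)
    then show ?thesis using theta3sq_pos[OF that(1)] by (simp add: zero_less_mult_iff)
  qed
  have "\<forall>\<^sub>F n in sequentially. theta4sq (2 ^ n) > 0"
    using order_tendstoD(1)[OF theta4sq_tendsto, of 0] by simp
  then obtain N where N: "\<And>n. n \<ge> N \<Longrightarrow> theta4sq (2 ^ n) > 0"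
    by (auto simp: eventually_sequentially)
  show ?thesis
  proof (cases "n \<le> N")
    case True
    then show ?thesis
      by (induction rule: inc_induct) (use N step[of "2 ^ _"] in auto)
  qed (use N in auto)
qed

text \<open>
  Landen's transformation makes the integral constant along \<open>s = 1, 2, 4, \<dots>\<close>. Both arguments tend to \<open>1\<close>,
  and monotonicity squeezes the integral towards its value \<open>\<pi> / 2\<close> for equal arguments \<open>1\<close>.
\<close>
lemma agm_int_theta3sq_theta4sq: "agm_int (theta3sq 1) (theta4sq 1) = pi / 2"
proof -
  define E where "E = (\<lambda>n. agm_int (theta3sq (2 ^ n)) (theta4sq (2 ^ n)))"
  have step: "E (Suc n) = E n" for n
  proof -
    have s: "(2::real) ^ n > 0" by simp
    have "theta4sq (2 * 2 ^ n) = sqrt (theta3sq (2 ^ n) * theta4sq (2 ^ n))"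
      using theta4sq_double[OF s] theta4sq_pos[of "Suc n"] by (simp add: real_sqrt_unique less_imp_le)
    then show ?thesis
      unfolding E_def power_Suc theta3sq_double[OF s]
      using agm_int_landen[OF theta3sq_pos[OF s] theta4sq_pos[of n]] by simp
  qed
  have const: "E n = E 0" for n by (induction n) (simp_all add: step)
  have le: "theta4sq (2 ^ n) \<le> theta3sq (2 ^ n)" for n
  proof -
    have "(theta4sq (2 ^ n))\<^sup>2 \<le> (theta3sq (2 ^ n))\<^sup>2"
      using jacobi_quartic_identity[of "2 ^ n"] by simp
    then show ?thesis using theta3sq_pos[of "2 ^ n"] by (intro power2_le_imp_le[of "theta4sq (2 ^ n)"]) auto
  qed
  have bounds: "pi / (2 * theta3sq (2 ^ n)) \<le> E 0" "E 0 \<le> pi / (2 * theta4sq (2 ^ n))" for n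
  proof -
    have a: "theta3sq (2 ^ n) > 0" and b: "theta4sq (2 ^ n) > 0"
      using theta3sq_pos[of "2 ^ n"] theta4sq_pos[of n] by auto
    show "pi / (2 * theta3sq (2 ^ n)) \<le> E 0"
      using agm_int_mono[OF a b order_refl le] agm_int_same(2)[OF a] const[of n] by (simp add: E_def)
    show "E 0 \<le> pi / (2 * theta4sq (2 ^ n))"
      using agm_int_mono[OF b b le order_refl] agm_int_same(2)[OF b] const[of n] by (simp add: E_def)
  qed
  have "(\<lambda>n. pi / (2 * theta3sq (2 ^ n))) \<longlonglongrightarrow> pi / (2 * 1)"
    by (intro tendsto_intros theta3sq_tendsto) simp
  then have "pi / 2 \<le> E 0" using bounds(1) by (intro LIMSEQ_le_const2) auto
  moreover have "(\<lambda>n. pi / (2 * theta4sq (2 ^ n))) \<longlonglongrightarrow> pi / (2 * 1)"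
    by (intro tendsto_intros theta4sq_tendsto) simp
  then have "E 0 \<le> pi / 2" using bounds(2) by (intro LIMSEQ_le_const) auto
  ultimately show ?thesis by (simp add: E_def)
qed

lemma agm_int_theta3sq_theta2sq_double:
  assumes s: "s > 0"
  shows "agm_int (theta3sq (2 * s)) (theta2sq (2 * s)) = 2 * agm_int (theta3sq s) (theta2sq s)"
proof -
  have a: "theta3sq (2 * s) > 0" and c: "theta2sq (2 * s) > 0" and a': "theta3sq s > 0" and c': "theta2sq s > 0"
    using s theta3sq_pos theta2sq_pos by auto
  have "sqrt (theta3sq (2 * s) * theta2sq (2 * s)) = theta2sq s / 2"
    using theta3sq_theta2sq_halve(2)[OF s] c' by (intro real_sqrt_unique) (auto simp: power_divide)
  moreover have "(theta3sq (2 * s) + theta2sq (2 * s)) / 2 = (1/2) * theta3sq s"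
    using theta3sq_theta2sq_halve(1)[OF s] by simp
  ultimately have "agm_int (theta3sq (2 * s)) (theta2sq (2 * s)) = agm_int ((1/2) * theta3sq s) ((1/2) * theta2sq s)"
    using agm_int_landen[OF a c] by (metis mult.commute times_divide_eq_right mult_1_right)
  also have "\<dots> = 2 * agm_int (theta3sq s) (theta2sq s)"
    using agm_int_scale[of "1/2", OF _ a' c'] by simp
  finally show ?thesis .
qed

text \<open>
  Here each doubling of \<open>s\<close> doubles the integral, so its value \<open>L\<close> at \<open>s = 1\<close> is the limit of the values at
  \<open>2\<^sup>n\<close> divided by \<open>2\<^sup>n\<close>. The first argument tends to \<open>1\<close> and the second decays like \<open>exp (- \<pi> 2\<^sup>n / 2)\<close>, so
  the logarithmic bounds on the integral give the limit \<open>\<pi> / 2\<close>.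
\<close>
lemma agm_int_theta3sq_theta2sq: "agm_int (theta3sq 1) (theta2sq 1) = pi / 2"
proof -
  define L where "L = agm_int (theta3sq 1) (theta2sq 1)"
  define C where "C = exp (pi / 2) * (theta2 1)\<^sup>2"
  have Cpos: "C > 0" unfolding C_def using shifted_theta_pos[of 1 "1/2"] by simp
  have L: "agm_int (theta3sq (2 ^ n)) (theta2sq (2 ^ n)) = 2 ^ n * L" for n
  proof (induction n)
    case (Suc n)
    then show ?case using agm_int_theta3sq_theta2sq_double[of "2 ^ n"] by simp
  qed (simp add: L_def)
  have a_ge: "theta3sq (2 ^ n) \<ge> 1" for n
    using shifted_theta_ge_term[of "2 ^ n" 0] by (simp add: theta3sq_def)
  have c_ge: "exp (- (pi / 2 * 2 ^ n)) \<le> theta2sq (2 ^ n)" for n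
  proof -
    have "exp (- pi * 2 ^ n * (1/2)\<^sup>2) ^ 2 \<le> theta2sq (2 ^ n)"
      unfolding theta2sq_def using shifted_theta_ge_term[of "2 ^ n" "1/2"] by (intro power_mono) auto
    then show ?thesis by (simp add: exp_of_nat_mult[symmetric] power2_eq_square mult_exp_exp)
  qed
  have c_le: "theta2sq (2 ^ n) \<le> C * exp (- (pi / 2 * 2 ^ n))" for n
  proof -
    have "theta2sq (2 ^ n) \<le> (exp (- pi * (2 ^ n - 1) / 4) * theta2 1)\<^sup>2"
      unfolding theta2sq_def using shifted_theta_pos[of "2 ^ n" "1/2"]
      by (intro power_mono theta2_upper) (auto intro: less_imp_le)
    also have "\<dots> = C * exp (- (pi / 2 * 2 ^ n))"
      by (simp add: C_def power_mult_distrib power2_eq_square mult_exp_exp field_simps)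
    finally show ?thesis .
  qed
  have c1: "\<forall>\<^sub>F n in sequentially. theta2sq (2 ^ n) < 1"
    using order_tendstoD(2)[OF theta2sq_tendsto, of 1] by simp
  have "\<forall>\<^sub>F n in sequentially. L \<le> pi / 2 + 3 / 2 ^ n"
    using c1
  proof eventually_elim
    case (elim n)
    have c: "theta2sq (2 ^ n) > 0" using theta2sq_pos[of "2 ^ n"] by simp
    have "2 ^ n * L \<le> agm_int 1 (theta2sq (2 ^ n))"
      unfolding L[symmetric] using a_ge[of n] c by (intro agm_int_mono) auto
    also have "\<dots> \<le> ln (1 / theta2sq (2 ^ n)) + 3" by (rule agm_int_upper_bound[OF c elim])
    also have "\<dots> = - ln (theta2sq (2 ^ n)) + 3" using c by (simp add: ln_div)
    also have "\<dots> \<le> pi / 2 * 2 ^ n + 3"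
    proof -
      have "ln (exp (- (pi / 2 * 2 ^ n))) \<le> ln (theta2sq (2 ^ n))"
        using c_ge[of n] by (subst ln_le_cancel_iff) (use c in auto)
      then show ?thesis by simp
    qed
    finally show ?case by (simp add: field_simps)
  qed
  moreover have "(\<lambda>n. pi / 2 + 3 / 2 ^ n) \<longlonglongrightarrow> pi / 2" by real_asymp
  ultimately have upper: "L \<le> pi / 2"
    by (intro tendsto_lowerbound[of "\<lambda>n. pi / 2 + 3 / 2 ^ n"]) auto
  have "\<forall>\<^sub>F n in sequentially. (pi / 2 - ln C / 2 ^ n) / theta3sq (2 ^ n) \<le> L"
    using c1
  proof eventually_elim
    case (elim n)
    define a where "a = theta3sq (2 ^ n)"
    define c where "c = theta2sq (2 ^ n)"
    have c: "c > 0" "c < 1" and a: "a \<ge> 1"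
      using theta2sq_pos[of "2 ^ n"] elim a_ge[of n] by (auto simp: a_def c_def)
    have "ln c \<le> ln (C * exp (- (pi / 2 * 2 ^ n)))"
      using c_le[of n] c Cpos by (subst ln_le_cancel_iff) (auto simp: c_def)
    then have "pi / 2 * 2 ^ n - ln C \<le> - ln c" using Cpos by (simp add: ln_mult)
    also have "\<dots> \<le> ln (a / c)" using c a by (simp add: ln_div)
    finally have "(pi / 2 * 2 ^ n - ln C) / a \<le> ln (a / c) / a"
      using a by (intro divide_right_mono) auto
    also have "\<dots> \<le> ln (a / c) / (a - c)"
      using a c by (intro divide_left_mono mult_pos_pos) auto
    also have "\<dots> \<le> agm_int a c" using a c by (intro agm_int_lower_bound) auto
    also have "\<dots> = 2 ^ n * L" by (simp add: a_def c_def L)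
    finally have "(pi / 2 * 2 ^ n - ln C) / a / 2 ^ n \<le> 2 ^ n * L / 2 ^ n"
      by (intro divide_right_mono) auto
    also have "(pi / 2 * 2 ^ n - ln C) / a / 2 ^ n = (pi / 2 - ln C / 2 ^ n) / a"
      by (simp add: diff_divide_distrib mult.commute)
    finally show ?case by (simp add: a_def)
  qed
  moreover have "(\<lambda>n. (pi / 2 - ln C / 2 ^ n) / theta3sq (2 ^ n)) \<longlonglongrightarrow> (pi / 2) / 1"
    by (intro tendsto_divide theta3sq_tendsto) (real_asymp, simp)
  ultimately have lower: "pi / 2 \<le> L"
    by (intro tendsto_upperbound[of "\<lambda>n. (pi / 2 - ln C / 2 ^ n) / theta3sq (2 ^ n)" "pi / 2"]) auto
  show ?thesis using upper lower by (simp add: L_def)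
qed

text \<open>
  The self-duality of \<open>q = e\<^sup>-\<^sup>\<pi>\<close>: the integrals of \<open>(\<vartheta>\<^sub>3\<^sup>2, \<vartheta>\<^sub>4\<^sup>2)\<close> and \<open>(\<vartheta>\<^sub>3\<^sup>2, \<vartheta>\<^sub>2\<^sup>2)\<close> agree, and the
  integral is strictly decreasing in its second argument.
\<close>
lemma theta4sq_eq_theta2sq: "theta4sq 1 = theta2sq 1"
proof (rule ccontr)
  have a: "theta3sq 1 > 0" and b: "theta4sq 1 > 0" and c: "theta2sq 1 > 0"
    using theta3sq_pos[of 1] theta4sq_pos[of 0] theta2sq_pos[of 1] by auto
  assume "theta4sq 1 \<noteq> theta2sq 1"
  then show False
    using agm_int_strict_mono[OF a b, of "theta2sq 1"] agm_int_strict_mono[OF a c, of "theta4sq 1"]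
      agm_int_theta3sq_theta4sq agm_int_theta3sq_theta2sq by linarith
qed

lemma theta3sq_eq_theta2sq: "theta3sq 1 = sqrt 2 * theta2sq 1"
proof -
  have "theta3sq 1 > 0" "theta2sq 1 > 0" using theta3sq_pos[of 1] theta2sq_pos[of 1] by auto
  moreover have "(theta3sq 1)\<^sup>2 = (sqrt 2 * theta2sq 1)\<^sup>2"
    unfolding jacobi_quartic_identity[OF zero_less_one] theta4sq_eq_theta2sq by (simp add: power_mult_distrib)
  ultimately show ?thesis by (intro power2_eq_imp_eq[of "theta3sq 1"]) auto
qed

text \<open>
  Since \<open>\<vartheta>\<^sub>3\<^sup>2 = \<surd>2 \<vartheta>\<^sub>2\<^sup>2\<close> at \<open>q = e\<^sup>-\<^sup>\<pi>\<close>, homogeneity reduces the integral with value \<open>\<pi> / 2\<close> to the lemniscatic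
  one, which is a Beta value; the reflection formula eliminates \<open>\<Gamma>(1/4)\<close>.
\<close>
lemma theta3_at_1: "theta3 1 = pi powr (1/4) / Gamma (3/4)"
proof -
  define c where "c = theta2sq 1"
  have c: "c > 0" unfolding c_def by (rule theta2sq_pos) simp
  have "pi / 2 = agm_int (c * sqrt 2) (c * 1)"
    using agm_int_theta3sq_theta2sq by (simp add: theta3sq_eq_theta2sq c_def mult.commute)
  also have "\<dots> = Beta (1/4) (1/2) / 4 / c"
    using c by (subst agm_int_scale) (auto simp: agm_int_lemniscate)
  finally have c_eq: "c = Beta (1/4) (1/2) / (2 * pi)" using c by (simp add: field_simps)
  have refl: "Gamma (1/4) * Gamma (3/4 :: real) = pi * sqrt 2"
  proof -
    have "complex_of_real (Gamma (1/4) * Gamma (3/4)) = Gamma (of_real (1/4)) * Gamma (1 - of_real (1/4))"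
      by (simp add: Gamma_complex_of_real[symmetric])
    also have "\<dots> = of_real pi / sin (of_real pi * of_real (1/4))"
      by (rule Gamma_reflection_complex)
    also have "\<dots> = complex_of_real (pi / sin (pi * (1/4)))"
      by (simp only: of_real_mult[symmetric] sin_of_real of_real_divide[symmetric])
    also have "pi / sin (pi * (1/4)) = pi * sqrt 2"
      by (simp add: sin_45 field_simps)
    finally show ?thesis by (simp only: of_real_eq_iff)
  qed
  have G: "Gamma (3/4 :: real) > 0" by (intro Gamma_real_pos) simp
  have "Beta (1/4) (1/2 :: real) = Gamma (1/4) * sqrt pi / Gamma (3/4)"
    by (simp add: Beta_def Gamma_one_half_real)
  also have "Gamma (1/4 :: real) = pi * sqrt 2 / Gamma (3/4)"
    using refl nonzero_eq_divide_eq[OF less_imp_neq[OF G, symmetric]] by blast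
  finally have "sqrt 2 * c = sqrt pi / (Gamma (3/4))\<^sup>2"
    using c_eq by (simp add: power2_eq_square field_simps)
  then have "(theta3 1)\<^sup>2 = sqrt pi / (Gamma (3/4))\<^sup>2"
    using theta3sq_eq_theta2sq by (simp add: theta3sq_def c_def)
  also have "sqrt pi = (pi powr (1/4))\<^sup>2"
    by (simp add: powr_power powr_half_sqrt)
  finally have "(theta3 1)\<^sup>2 = (pi powr (1/4) / Gamma (3/4))\<^sup>2" by (simp add: power_divide)
  moreover have "theta3 1 > 0" by (rule shifted_theta_pos) simp
  ultimately show ?thesis using G by (intro power2_eq_imp_eq[of "theta3 1"]) auto
qed

section \<open>Special values of Ramanujan's function\<close>

lemma theta2_at_1: "theta2 1 = theta3 1 / 2 powr (1/4)"
proof (rule power2_eq_imp_eq)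
  have "(theta3 1)\<^sup>2 = sqrt 2 * (theta2 1)\<^sup>2"
    using theta3sq_eq_theta2sq by (simp add: theta3sq_def theta2sq_def)
  moreover have "(2 powr (1/4))\<^sup>2 = sqrt 2" by (simp add: powr_power powr_half_sqrt)
  ultimately show "(theta2 1)\<^sup>2 = (theta3 1 / 2 powr (1/4))\<^sup>2"
    by (simp add: power_divide)
qed (use shifted_theta_pos[of 1] in \<open>auto intro: less_imp_le\<close>)

text \<open>
  The duplication formulas, read from \<open>s = 1\<close> downwards, carry the values at \<open>1\<close> to \<open>1/2\<close> and \<open>1/4\<close>.
\<close>
lemma theta2_at_half: "theta2 (1/2) = theta3 1 * 2 powr (3/8)"
proof (rule power2_eq_imp_eq)
  have "(theta2 (1/2))\<^sup>2 = (theta3 1)\<^sup>2 * (2 powr 1 / 2 powr (1/4))"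
    using theta2_squared_double[of "1/2"] by (simp add: theta2_at_1 power2_eq_square)
  also have "2 powr 1 / 2 powr (1/4) = (2 powr (3/8) :: real)\<^sup>2"
    unfolding powr_diff[symmetric] by (simp add: powr_power)
  finally show "(theta2 (1/2))\<^sup>2 = (theta3 1 * 2 powr (3/8))\<^sup>2"
    by (simp add: power_mult_distrib)
qed (use shifted_theta_pos in \<open>auto intro!: less_imp_le mult_pos_pos\<close>)

lemma theta2_at_quarter: "theta2 (1/4) = theta3 1 * ((sqrt 2 + 1) powr (1/4) * 2 powr (9/16))"
proof -
  let ?r = "theta3 1 * ((sqrt 2 + 1) powr (1/4) * 2 powr (9/16))"
  have pos: "theta3 1 > 0" "theta2 (1/4) > 0" by (simp_all add: shifted_theta_pos)
  have sq2: "2 powr (1/2) = sqrt 2" by (simp add: powr_half_sqrt)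
  have pow4: "(x powr a) ^ 4 = x powr (4 * a)" if "x > 0" for x a :: real
    using that by (simp add: powr_power mult.commute)
  have "(theta2 (1/4)) ^ 4 = ((theta2 (1/4))\<^sup>2)\<^sup>2" by simp
  also have "\<dots> = 4 * (theta2 (1/2))\<^sup>2 * (theta3 (1/2))\<^sup>2"
    using theta2_squared_double[of "1/4"] by (simp add: power_mult_distrib)
  also have "(theta3 (1/2))\<^sup>2 = (theta3 1)\<^sup>2 * (1 + 1 / sqrt 2)"
    using theta3_squared_double[of "1/2"] by (simp add: theta2_at_1 power_divide powr_power sq2 algebra_simps)
  also have "1 + 1 / sqrt 2 = (sqrt 2 + 1) / 2 powr (1/2)"
    by (simp add: sq2 field_simps)
  also have "4 * (theta2 (1/2))\<^sup>2 * ((theta3 1)\<^sup>2 * ((sqrt 2 + 1) / 2 powr (1/2))) =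
      (theta3 1) ^ 4 * ((sqrt 2 + 1) * (2 powr 2 * 2 powr (3/4) / 2 powr (1/2)))"
  proof -
    have "(2 powr (3/8) :: real)\<^sup>2 = 2 powr (3/4)" by (simp add: powr_power)
    moreover have "(theta3 1) ^ 4 = (theta3 1)\<^sup>2 * (theta3 1)\<^sup>2" by simp
    ultimately show ?thesis by (simp add: theta2_at_half power_mult_distrib)
  qed
  also have "2 powr 2 * 2 powr (3/4) / 2 powr (1/2) = (2 powr (9/4) :: real)"
    by (simp only: powr_add[symmetric] powr_diff[symmetric]) simp
  also have "(theta3 1) ^ 4 * ((sqrt 2 + 1) * 2 powr (9/4)) = ?r ^ 4"
    by (simp add: power_mult_distrib pow4 add_pos_nonneg)
  finally have "theta2 (1/4) ^ 4 = ?r ^ 4" .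
  moreover have "?r \<ge> 0" using pos by simp
  ultimately show ?thesis using pos by (metis less_imp_le power_eq_imp_eq_base zero_less_numeral)
qed

lemma ramanujan_psi_eq_theta2:
  assumes "s > 0" shows "ramanujan_psi (exp (- 2 * pi * s)) = theta2 s * exp (pi * s / 4) / 2"
  using theta2_eq_ramanujan_psi[OF assms] by (simp add: exp_minus field_simps)

lemma ramanujan_psi_exp_minus_2pi:
  "ramanujan_psi (exp (- 2 * pi)) = pi powr (1/4) / Gamma (3/4) * (exp (pi / 4) / 2 powr (5/4))"
proof -
  have "ramanujan_psi (exp (- 2 * pi)) = theta3 1 * (exp (pi / 4) / (2 powr (1/4) * 2 powr 1))"
    using ramanujan_psi_eq_theta2[of 1] by (simp add: theta2_at_1)
  also have "2 powr (1/4) * 2 powr 1 = (2 powr (5/4) :: real)"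
    by (simp only: powr_add[symmetric]) simp
  finally show ?thesis by (simp only: theta3_at_1)
qed

lemma ramanujan_psi_exp_minus_pi:
  "ramanujan_psi (exp (- pi)) = pi powr (1/4) / Gamma (3/4) * (exp (pi / 8) / 2 powr (5/8))"
proof -
  have "ramanujan_psi (exp (- pi)) = theta3 1 * (exp (pi / 8) / (2 powr 1 / 2 powr (3/8)))"
    using ramanujan_psi_eq_theta2[of "1/2"] by (simp add: theta2_at_half)
  also have "2 powr 1 / 2 powr (3/8) = (2 powr (5/8) :: real)"
    by (simp only: powr_diff[symmetric]) simp
  finally show ?thesis by (simp only: theta3_at_1)
qed

lemma ramanujan_psi_exp_minus_half_pi:
  "ramanujan_psi (exp (- (1/2) * pi)) =
     pi powr (1/4) / Gamma (3/4) * ((sqrt 2 + 1) powr (1/4) * exp (pi / 16) / 2 powr (7/16))"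
proof -
  have "ramanujan_psi (exp (- (1/2) * pi)) =
      theta3 1 * ((sqrt 2 + 1) powr (1/4) * exp (pi / 16) / (2 powr 1 / 2 powr (9/16)))"
    using ramanujan_psi_eq_theta2[of "1/4"] by (simp add: theta2_at_quarter)
  also have "2 powr 1 / 2 powr (9/16) = (2 powr (7/16) :: real)"
    by (simp only: powr_diff[symmetric]) simp
  finally show ?thesis by (simp only: theta3_at_1)
qed

theorem corollary4p8:
  shows "(\<forall>k::real. k > 0 \<longrightarrow>
           set_integrable lborel {0..} (\<lambda>t::real. exp (- (t\<^sup>2) / 2) / sqrt (2 * pi) *
             ((cos (sqrt (k * pi) * t) - exp (k * pi / 2)) /
              (cos (sqrt (k * pi) * t) - cosh (k * pi / 2)))) \<and>
           ramanujan_psi (exp (- k * pi)) =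
           (LBINT t:{0..}. exp (- (t\<^sup>2) / 2) / sqrt (2 * pi) *
             ((cos (sqrt (k * pi) * t) - exp (k * pi / 2)) /
              (cos (sqrt (k * pi) * t) - cosh (k * pi / 2))))) \<and>
         (ramanujan_psi (exp (- pi)) =
           pi powr (1/4) / Gamma (3/4) * (exp (pi / 8) / 2 powr (5/8))) \<and>
         (pi powr (1/4) / Gamma (3/4) * (exp (pi / 8) / 2 powr (5/8)) =
           (LBINT t:{0..}. exp (- (t\<^sup>2) / 2) / sqrt (2 * pi) *
             ((cos (sqrt pi * t) - exp (pi / 2)) /
              (cos (sqrt pi * t) - cosh (pi / 2))))) \<and>
         (ramanujan_psi (exp (- 2 * pi)) =
           pi powr (1/4) / Gamma (3/4) * (exp (pi / 4) / 2 powr (5/4))) \<and>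
         (pi powr (1/4) / Gamma (3/4) * (exp (pi / 4) / 2 powr (5/4)) =
           (LBINT t:{0..}. exp (- (t\<^sup>2) / 2) / sqrt (2 * pi) *
             ((cos (sqrt (2 * pi) * t) - exp pi) /
              (cos (sqrt (2 * pi) * t) - cosh pi)))) \<and>
         (ramanujan_psi (exp (- (1/2) * pi)) =
           pi powr (1/4) / Gamma (3/4) *
             ((sqrt 2 + 1) powr (1/4) * exp (pi / 16) / 2 powr (7/16))) \<and>
         (pi powr (1/4) / Gamma (3/4) *
             ((sqrt 2 + 1) powr (1/4) * exp (pi / 16) / 2 powr (7/16)) =
           (LBINT t:{0..}. exp (- (t\<^sup>2) / 2) / sqrt (2 * pi) *
             ((cos (sqrt (pi / 2) * t) - exp (pi / 4)) /
              (cos (sqrt (pi / 2) * t) - cosh (pi / 4)))))"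
proof (intro conjI allI impI)
  fix k :: real assume "k > 0"
  note rep = ramanujan_psi_integral_representation[OF this]
  show "set_integrable lborel {0..} (\<lambda>t::real. exp (- (t\<^sup>2) / 2) / sqrt (2 * pi) *
      ((cos (sqrt (k * pi) * t) - exp (k * pi / 2)) / (cos (sqrt (k * pi) * t) - cosh (k * pi / 2))))"
    by (rule rep(1))
  show "ramanujan_psi (exp (- k * pi)) = (LBINT t:{0..}. exp (- (t\<^sup>2) / 2) / sqrt (2 * pi) *
      ((cos (sqrt (k * pi) * t) - exp (k * pi / 2)) / (cos (sqrt (k * pi) * t) - cosh (k * pi / 2))))"
    by (rule rep(2))
next
  show "ramanujan_psi (exp (- pi)) = pi powr (1/4) / Gamma (3/4) * (exp (pi / 8) / 2 powr (5/8))"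
    by (rule ramanujan_psi_exp_minus_pi)
  then show "pi powr (1/4) / Gamma (3/4) * (exp (pi / 8) / 2 powr (5/8)) =
      (LBINT t:{0..}. exp (- (t\<^sup>2) / 2) / sqrt (2 * pi) *
        ((cos (sqrt pi * t) - exp (pi / 2)) / (cos (sqrt pi * t) - cosh (pi / 2))))"
    using ramanujan_psi_integral_representation(2)[of 1] by simp
  show "ramanujan_psi (exp (- 2 * pi)) = pi powr (1/4) / Gamma (3/4) * (exp (pi / 4) / 2 powr (5/4))"
    by (rule ramanujan_psi_exp_minus_2pi)
  then show "pi powr (1/4) / Gamma (3/4) * (exp (pi / 4) / 2 powr (5/4)) =
      (LBINT t:{0..}. exp (- (t\<^sup>2) / 2) / sqrt (2 * pi) *
        ((cos (sqrt (2 * pi) * t) - exp pi) / (cos (sqrt (2 * pi) * t) - cosh pi)))"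
    using ramanujan_psi_integral_representation(2)[of 2] by simp
  show "ramanujan_psi (exp (- (1/2) * pi)) =
      pi powr (1/4) / Gamma (3/4) * ((sqrt 2 + 1) powr (1/4) * exp (pi / 16) / 2 powr (7/16))"
    by (rule ramanujan_psi_exp_minus_half_pi)
  then show "pi powr (1/4) / Gamma (3/4) * ((sqrt 2 + 1) powr (1/4) * exp (pi / 16) / 2 powr (7/16)) =
      (LBINT t:{0..}. exp (- (t\<^sup>2) / 2) / sqrt (2 * pi) *
        ((cos (sqrt (pi / 2) * t) - exp (pi / 4)) / (cos (sqrt (pi / 2) * t) - cosh (pi / 4))))"
    using ramanujan_psi_integral_representation(2)[of "1/2"] by simp
qed

end
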